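(* Let $G$ be a finite group acting faithfully on a finite set $M$, let $H$ be an orbit-maximal subgroup of $G$ and let $X$ be a simple complex $\mathrm{N}_G(H)/H$-module. Let $(\cdot,\cdot)$ be the form on the simple $\mathcal{FP}^+(G,M)$-module $L(H,X)$ constructed in the context from an arbitrary Hermitian scalar product on the image of $\overline{H}$. Then $(\cdot,\cdot)$ is a Hermitian scalar product on $L(H,X)$ and $$(\sigma(v),w)=(v,\sigma^\star(w))$$ for all $\sigma\in\mathcal{FP}^+(G,M)$ and $v,w\in L(H,X)$.
   Context: The factorpower $\mathcal{FP}^+(G,M)$ of a finite group $G$ acting (on the left) on a finite set $M$ is the finite monoid whose elements are the classes $\overline{A}$ of nonempty subsets $A\subset G$ under the congruence $A\sim_M B$ iff $\{a(m)\mid a\in A\}=\{b(m)\mid b\in B\}$ for all $m\in M$, with multiplication $\overline{A}\,\overline{B}=\overline{AB}$, where $AB=\{ab\mid a\in A,b\in B\}$. An element $g\in G$ is identified with $\overline{\{g\}}$. The anti-involution $\star$ is $(\overline{B})^\star=\overline{\{\sigma^{-1}\mid\sigma\in B\}}$. Two subgroups of $G$ are orbit-equivalent if they have the same orbits on $M$; a subgroup is orbit-maximal if it is the (unique) maximal element, with respect to inclusion, among all subgroups orbit-equivalent to it. For $H$ orbit-maximal, $\overline{H}$ is an idempotent and $X\mapsto\overline{X}$ identifies $\mathrm{N}_G(H)/H$ with the maximal subgroup ($\mathcal{H}$-class) of $\mathcal{FP}^+(G,M)$ with identity $\overline{H}$, where $\mathrm{N}_G(H)$ is the normalizer of $H$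 in $G$. Let $\mathcal{L}_H$ be the $\mathcal{L}$-class of $\overline{H}$ in $\mathcal{FP}^+(G,M)$, and let $V_H$ be the formal $\mathbb{C}$-span of $\mathcal{L}_H$ with the $\mathcal{FP}^+(G,M)$-$\mathrm{N}_G(H)/H$-bimodule structure given for $x\in\mathcal{L}_H$, $s\in\mathcal{FP}^+(G,M)$, $g\in\mathrm{N}_G(H)/H$ by $s\cdot x\cdot g=sxg$ if $sxg\in\mathcal{L}_H$, and $0$ otherwise. Put $L(H,X)=V_H\otimes_{\mathrm{N}_G(H)/H}X$. Construction of the form. Let $H_1=H,H_2,\dots,H_k$ be the list of all pairwise different subgroups of $G$ conjugate to $H$, $\varepsilon_i=\overline{H_i}$, and let $V_i$ be the image of $\varepsilon_i$ on $L(H,X)$; one has $L(H,X)=\bigoplus_{i=1}^kV_i$. Put $g_1=e$ and for $i=2,\dots,k$ fix $g_i\in G$ with $H_i=g_i^{-1}Hg_i$; then $g_i$ maps $V_i$ to $V_1$. Let $(\cdot,\cdot)_1$ be any Hermitian scalar product (positive definite) on $V_1$. For $v,w\in V_1$ set $(v,w)=\sum_{g\in\mathrm{N}_G(H)/H}(g(v),g(w))_1$. For $v,w\in V_i$ set $(v,w)=(g_i(v),g_i(w))$. For $v\in V_i$, $w\in V_j$ with $i\neq j$ set $(v,w)=0$. Extend $(\cdot,\cdot)$ to $L(H,X)$ sesquilinearly. *)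

theory Defs
  imports "HOL-Algebra.Algebra" "HOL-Algebra.Algebraic_Closure_Type"
begin

section \<open>The factorpower of a group action\<close>

definition fp_rel :: "('g, 'z) monoid_scheme \<Rightarrow> 'm set \<Rightarrow> ('g \<Rightarrow> 'm \<Rightarrow> 'm) \<Rightarrow> ('g set \<times> 'g set) set" where
  "fp_rel G M \<phi> =
     {(A, B). A \<noteq> {} \<and> A \<subseteq> carrier G \<and> B \<noteq> {} \<and> B \<subseteq> carrier G \<and>
        (\<forall>m\<in>M. {\<phi> a m | a. a \<in> A} = {\<phi> b m | b. b \<in> B})}"

definition fp_class :: "('g, 'z) monoid_scheme \<Rightarrow> 'm set \<Rightarrow> ('g \<Rightarrow> 'm \<Rightarrow> 'm) \<Rightarrow> 'g set \<Rightarrow> 'g set set" where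
  "fp_class G M \<phi> A = fp_rel G M \<phi> `` {A}"

text \<open>The product of two classes is written as the union of the classes of all products of
  representatives; as \<^const>\<open>fp_rel\<close> is a congruence, these classes all coincide.\<close>

definition factorpower :: "('g, 'z) monoid_scheme \<Rightarrow> 'm set \<Rightarrow> ('g \<Rightarrow> 'm \<Rightarrow> 'm) \<Rightarrow> 'g set set monoid" where
  "factorpower G M \<phi> =
     \<lparr>carrier = {A. A \<noteq> {} \<and> A \<subseteq> carrier G} // fp_rel G M \<phi>,
      monoid.mult = (\<lambda>x y. \<Union>A\<in>x. \<Union>B\<in>y. fp_class G M \<phi> (A <#>\<^bsub>G\<^esub> B)),
      one = fp_class G M \<phi> {\<one>\<^bsub>G\<^esub>}\<rparr>"

definition fp_star :: "('g, 'z) monoid_scheme \<Rightarrow> 'm set \<Rightarrow> ('g \<Rightarrow> 'm \<Rightarrow> 'm) \<Rightarrow> 'g set set \<Rightarrow> 'g set set" where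
  "fp_star G M \<phi> x = (\<Union>B\<in>x. fp_class G M \<phi> (set_inv\<^bsub>G\<^esub> B))"

definition orbit_equivalent ::
    "('g, 'z) monoid_scheme \<Rightarrow> 'm set \<Rightarrow> ('g \<Rightarrow> 'm \<Rightarrow> 'm) \<Rightarrow> 'g set \<Rightarrow> 'g set \<Rightarrow> bool" where
  "orbit_equivalent G M \<phi> H K \<longleftrightarrow>
     orbits (G\<lparr>carrier := H\<rparr>) M \<phi> = orbits (G\<lparr>carrier := K\<rparr>) M \<phi>"

definition orbit_maximal :: "('g, 'z) monoid_scheme \<Rightarrow> 'm set \<Rightarrow> ('g \<Rightarrow> 'm \<Rightarrow> 'm) \<Rightarrow> 'g set \<Rightarrow> bool" where
  "orbit_maximal G M \<phi> H \<longleftrightarrow>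
     subgroup H G \<and>
     (\<forall>K. subgroup K G \<and> orbit_equivalent G M \<phi> H K \<and> H \<subseteq> K \<longrightarrow> K = H)"

text \<open>Green's relation: for a monoid, two elements are \<open>\<L>\<close>-related iff they generate the same
  principal left ideal.\<close>

definition Green_L_class :: "('s, 'z) monoid_scheme \<Rightarrow> 's \<Rightarrow> 's set" where
  "Green_L_class S e =
     {x \<in> carrier S. (\<lambda>s. s \<otimes>\<^bsub>S\<^esub> x) ` carrier S = (\<lambda>s. s \<otimes>\<^bsub>S\<^esub> e) ` carrier S}"

definition normalizer_quotient :: "('g, 'z) monoid_scheme \<Rightarrow> 'g set \<Rightarrow> 'g set monoid" where
  "normalizer_quotient G H = (G\<lparr>carrier := normalizer G H\<rparr>) Mod H"


section \<open>Complex vector spaces\<close>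

text \<open>Complex vector spaces are modules over the following ring. In the concrete modules
  constructed below the ring components \<^const>\<open>monoid.mult\<close> and \<^const>\<open>monoid.one\<close> of the module
  record carry no meaning.\<close>

abbreviation complex_ring :: "complex ring" where
  "complex_ring \<equiv> ring_of_type_algebra"

text \<open>The formal complex span of a set \<open>B\<close>: finitely supported functions vanishing off \<open>B\<close>.\<close>

definition formal_span :: "'b set \<Rightarrow> (complex, 'b \<Rightarrow> complex) module" where
  "formal_span B =
     \<lparr>carrier = {f. finite {x. f x \<noteq> 0} \<and> {x. f x \<noteq> 0} \<subseteq> B},
      monoid.mult = undefined, monoid.one = undefined,
      ring.zero = (\<lambda>_. 0), ring.add = (\<lambda>f h x. f x + h x),
      module.smult = (\<lambda>c f x. c * f x)\<rparr>"

definition single_vec :: "'b \<Rightarrow> 'b \<Rightarrow> complex" where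
  "single_vec x = (\<lambda>y. if y = x then 1 else 0)"

text \<open>The linear extension of a map \<open>h\<close> given on basis elements.\<close>

definition lin_ext :: "('b \<Rightarrow> 'c \<Rightarrow> complex) \<Rightarrow> ('b \<Rightarrow> complex) \<Rightarrow> 'c \<Rightarrow> complex" where
  "lin_ext h f = (\<lambda>y. \<Sum>x | f x \<noteq> 0. f x * h x y)"

definition quotient_module :: "(complex, 'v) module \<Rightarrow> 'v set \<Rightarrow> (complex, 'v set) module" where
  "quotient_module F W =
     \<lparr>carrier = a_rcosets\<^bsub>F\<^esub> W,
      monoid.mult = undefined, monoid.one = undefined,
      ring.zero = W, ring.add = set_add F,
      module.smult = (\<lambda>c A. \<Union>a\<in>A. W +>\<^bsub>F\<^esub> (c \<odot>\<^bsub>F\<^esub> a))\<rparr>"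

text \<open>The tensor product, over the group algebra of a group with underlying set \<open>Q\<close>, of a space
  \<open>V\<close> with right action \<open>r\<close> and a space \<open>U\<close> with left action \<open>\<rho>\<close>: the formal span of
  \<open>V \<times> U\<close> modulo the bilinearity relations and \<open>v q \<otimes> x = v \<otimes> q x\<close>.\<close>

definition tensor_relations ::
    "'q set \<Rightarrow> (complex, 'v) module \<Rightarrow> ('q \<Rightarrow> 'v \<Rightarrow> 'v) \<Rightarrow> (complex, 'x) module \<Rightarrow> ('q \<Rightarrow> 'x \<Rightarrow> 'x)
      \<Rightarrow> ('v \<times> 'x \<Rightarrow> complex) set" where
  "tensor_relations Q V r U \<rho> =
     (let F = formal_span (carrier V \<times> carrier U); d = (\<lambda>v x. single_vec (v, x)) in
        {d (v \<oplus>\<^bsub>V\<^esub> v') x \<ominus>\<^bsub>F\<^esub> (d v x \<oplus>\<^bsub>F\<^esub> d v' x) | v v' x.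
           v \<in> carrier V \<and> v' \<in> carrier V \<and> x \<in> carrier U} \<union>
        {d v (x \<oplus>\<^bsub>U\<^esub> x') \<ominus>\<^bsub>F\<^esub> (d v x \<oplus>\<^bsub>F\<^esub> d v x') | v x x'.
           v \<in> carrier V \<and> x \<in> carrier U \<and> x' \<in> carrier U} \<union>
        {d (c \<odot>\<^bsub>V\<^esub> v) x \<ominus>\<^bsub>F\<^esub> c \<odot>\<^bsub>F\<^esub> d v x | c v x.
           v \<in> carrier V \<and> x \<in> carrier U} \<union>
        {d v (c \<odot>\<^bsub>U\<^esub> x) \<ominus>\<^bsub>F\<^esub> c \<odot>\<^bsub>F\<^esub> d v x | c v x.
           v \<in> carrier V \<and> x \<in> carrier U} \<union>
        {d (r q v) x \<ominus>\<^bsub>F\<^esub> d v (\<rho> q x) | q v x.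
           q \<in> Q \<and> v \<in> carrier V \<and> x \<in> carrier U})"

definition tensor_kernel ::
    "'q set \<Rightarrow> (complex, 'v) module \<Rightarrow> ('q \<Rightarrow> 'v \<Rightarrow> 'v) \<Rightarrow> (complex, 'x) module \<Rightarrow> ('q \<Rightarrow> 'x \<Rightarrow> 'x)
      \<Rightarrow> ('v \<times> 'x \<Rightarrow> complex) set" where
  "tensor_kernel Q V r U \<rho> =
     (\<lambda>W. submodule W complex_ring (formal_span (carrier V \<times> carrier U)))
       hull tensor_relations Q V r U \<rho>"

definition tensor_product ::
    "'q set \<Rightarrow> (complex, 'v) module \<Rightarrow> ('q \<Rightarrow> 'v \<Rightarrow> 'v) \<Rightarrow> (complex, 'x) module \<Rightarrow> ('q \<Rightarrow> 'x \<Rightarrow> 'x)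
      \<Rightarrow> (complex, ('v \<times> 'x \<Rightarrow> complex) set) module" where
  "tensor_product Q V r U \<rho> =
     quotient_module (formal_span (carrier V \<times> carrier U)) (tensor_kernel Q V r U \<rho>)"

text \<open>The endomorphism \<open>v \<otimes> x \<mapsto> t v \<otimes> x\<close> of the tensor product.\<close>

definition tensor_left ::
    "'q set \<Rightarrow> (complex, 'v) module \<Rightarrow> ('q \<Rightarrow> 'v \<Rightarrow> 'v) \<Rightarrow> (complex, 'x) module \<Rightarrow> ('q \<Rightarrow> 'x \<Rightarrow> 'x)
      \<Rightarrow> ('v \<Rightarrow> 'v) \<Rightarrow> ('v \<times> 'x \<Rightarrow> complex) set \<Rightarrow> ('v \<times> 'x \<Rightarrow> complex) set" where
  "tensor_left Q V r U \<rho> t c =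
     (\<Union>f\<in>c. tensor_kernel Q V r U \<rho> +>\<^bsub>formal_span (carrier V \<times> carrier U)\<^esub>
        lin_ext (\<lambda>(v, x). single_vec (t v, x)) f)"

definition linear_representation ::
    "('q, 'z) monoid_scheme \<Rightarrow> (complex, 'x) module \<Rightarrow> ('q \<Rightarrow> 'x \<Rightarrow> 'x) \<Rightarrow> bool" where
  "linear_representation Q U \<rho> \<longleftrightarrow>
     module complex_ring U \<and>
     (\<forall>q\<in>carrier Q. \<rho> q \<in> carrier U \<rightarrow> carrier U \<and>
        (\<forall>x\<in>carrier U. \<forall>y\<in>carrier U. \<rho> q (x \<oplus>\<^bsub>U\<^esub> y) = \<rho> q x \<oplus>\<^bsub>U\<^esub> \<rho> q y) \<and>
        (\<forall>c. \<forall>x\<in>carrier U. \<rho> q (c \<odot>\<^bsub>U\<^esub> x) = c \<odot>\<^bsub>U\<^esub> \<rho> q x)) \<and>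
     (\<forall>x\<in>carrier U. \<rho> \<one>\<^bsub>Q\<^esub> x = x) \<and>
     (\<forall>p\<in>carrier Q. \<forall>q\<in>carrier Q. \<forall>x\<in>carrier U. \<rho> (p \<otimes>\<^bsub>Q\<^esub> q) x = \<rho> p (\<rho> q x))"

definition simple_representation ::
    "('q, 'z) monoid_scheme \<Rightarrow> (complex, 'x) module \<Rightarrow> ('q \<Rightarrow> 'x \<Rightarrow> 'x) \<Rightarrow> bool" where
  "simple_representation Q U \<rho> \<longleftrightarrow>
     linear_representation Q U \<rho> \<and>
     carrier U \<noteq> {\<zero>\<^bsub>U\<^esub>} \<and>
     (\<forall>W. submodule W complex_ring U \<and> (\<forall>q\<in>carrier Q. \<rho> q ` W \<subseteq> W) \<longrightarrow>
        W = {\<zero>\<^bsub>U\<^esub>} \<or> W = carrier U)"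

text \<open>Sesquilinear means linear in the first and antilinear in the second argument; the latter
  follows from the former by Hermitian symmetry, which also makes \<open>B v v\<close> real.\<close>

definition hermitian_scalar_product :: "(complex, 'v) module \<Rightarrow> ('v \<Rightarrow> 'v \<Rightarrow> complex) \<Rightarrow> bool" where
  "hermitian_scalar_product V B \<longleftrightarrow>
     (\<forall>u\<in>carrier V. \<forall>v\<in>carrier V. \<forall>w\<in>carrier V. B (u \<oplus>\<^bsub>V\<^esub> v) w = B u w + B v w) \<and>
     (\<forall>c. \<forall>v\<in>carrier V. \<forall>w\<in>carrier V. B (c \<odot>\<^bsub>V\<^esub> v) w = c * B v w) \<and>
     (\<forall>v\<in>carrier V. \<forall>w\<in>carrier V. B w v = cnj (B v w)) \<and>
     (\<forall>v\<in>carrier V. v \<noteq> \<zero>\<^bsub>V\<^esub> \<longrightarrow> Re (B v v) > 0)"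

text \<open>The components of \<open>v\<close> in a direct sum decomposition \<open>V 0 \<oplus> \<dots> \<oplus> V (k - 1)\<close> of \<open>L\<close>.\<close>

definition components :: "(complex, 'v) module \<Rightarrow> nat \<Rightarrow> (nat \<Rightarrow> 'v set) \<Rightarrow> 'v \<Rightarrow> nat \<Rightarrow> 'v" where
  "components L k V v = (THE u. u \<in> PiE {..<k} V \<and> v = finsum L u {..<k})"


section \<open>The module \<open>L(H, U)\<close>\<close>

definition L_H :: "('g, 'z) monoid_scheme \<Rightarrow> 'm set \<Rightarrow> ('g \<Rightarrow> 'm \<Rightarrow> 'm) \<Rightarrow> 'g set \<Rightarrow> 'g set set set" where
  "L_H G M \<phi> H = Green_L_class (factorpower G M \<phi>) (fp_class G M \<phi> H)"

definition V_H ::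
    "('g, 'z) monoid_scheme \<Rightarrow> 'm set \<Rightarrow> ('g \<Rightarrow> 'm \<Rightarrow> 'm) \<Rightarrow> 'g set
      \<Rightarrow> (complex, 'g set set \<Rightarrow> complex) module" where
  "V_H G M \<phi> H = formal_span (L_H G M \<phi> H)"

text \<open>The bimodule structure \<open>v \<mapsto> s \<cdot> v \<cdot> C\<close> for \<open>s\<close> in the factorpower and \<open>C\<close> in
  \<open>N(H)/H\<close>. A coset \<open>C\<close>, being a subset of the group, is identified with its class in the
  factorpower. One-sided actions arise by taking the identity on the other side; the identity
  of \<open>N(H)/H\<close> is the coset \<open>H\<close>.\<close>

definition V_H_action ::
    "('g, 'z) monoid_scheme \<Rightarrow> 'm set \<Rightarrow> ('g \<Rightarrow> 'm \<Rightarrow> 'm) \<Rightarrow> 'g set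
      \<Rightarrow> 'g set set \<Rightarrow> 'g set \<Rightarrow> ('g set set \<Rightarrow> complex) \<Rightarrow> ('g set set \<Rightarrow> complex)" where
  "V_H_action G M \<phi> H s C =
     lin_ext (\<lambda>x. let y = s \<otimes>\<^bsub>factorpower G M \<phi>\<^esub> x \<otimes>\<^bsub>factorpower G M \<phi>\<^esub> fp_class G M \<phi> C
                  in if y \<in> L_H G M \<phi> H then single_vec y else (\<lambda>_. 0))"

abbreviation V_H_left where
  "V_H_left G M \<phi> H s \<equiv> V_H_action G M \<phi> H s H"

abbreviation V_H_right where
  "V_H_right G M \<phi> H C \<equiv> V_H_action G M \<phi> H \<one>\<^bsub>factorpower G M \<phi>\<^esub> C"

type_synonym ('g, 'x) L_elem = "(('g set set \<Rightarrow> complex) \<times> 'x \<Rightarrow> complex) set"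

definition L_module ::
    "('g, 'z) monoid_scheme \<Rightarrow> 'm set \<Rightarrow> ('g \<Rightarrow> 'm \<Rightarrow> 'm) \<Rightarrow> 'g set
      \<Rightarrow> (complex, 'x) module \<Rightarrow> ('g set \<Rightarrow> 'x \<Rightarrow> 'x) \<Rightarrow> (complex, ('g, 'x) L_elem) module" where
  "L_module G M \<phi> H U \<rho> =
     tensor_product (carrier (normalizer_quotient G H)) (V_H G M \<phi> H) (V_H_right G M \<phi> H) U \<rho>"

definition L_action ::
    "('g, 'z) monoid_scheme \<Rightarrow> 'm set \<Rightarrow> ('g \<Rightarrow> 'm \<Rightarrow> 'm) \<Rightarrow> 'g set
      \<Rightarrow> (complex, 'x) module \<Rightarrow> ('g set \<Rightarrow> 'x \<Rightarrow> 'x)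
      \<Rightarrow> 'g set set \<Rightarrow> ('g, 'x) L_elem \<Rightarrow> ('g, 'x) L_elem" where
  "L_action G M \<phi> H U \<rho> s =
     tensor_left (carrier (normalizer_quotient G H)) (V_H G M \<phi> H) (V_H_right G M \<phi> H) U \<rho>
       (V_H_left G M \<phi> H s)"

text \<open>The image on \<open>L(H, U)\<close> of the idempotent given by a subgroup \<open>K\<close>.\<close>

definition idem_image ::
    "('g, 'z) monoid_scheme \<Rightarrow> 'm set \<Rightarrow> ('g \<Rightarrow> 'm \<Rightarrow> 'm) \<Rightarrow> 'g set
      \<Rightarrow> (complex, 'x) module \<Rightarrow> ('g set \<Rightarrow> 'x \<Rightarrow> 'x) \<Rightarrow> 'g set \<Rightarrow> ('g, 'x) L_elem set" where
  "idem_image G M \<phi> H U \<rho> K =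
     L_action G M \<phi> H U \<rho> (fp_class G M \<phi> K) ` carrier (L_module G M \<phi> H U \<rho>)"


section \<open>The form\<close>

text \<open>\<open>b\<close> is the chosen scalar product on the image of the idempotent of \<open>H\<close>.\<close>

definition averaged_form ::
    "('g, 'z) monoid_scheme \<Rightarrow> 'm set \<Rightarrow> ('g \<Rightarrow> 'm \<Rightarrow> 'm) \<Rightarrow> 'g set
      \<Rightarrow> (complex, 'x) module \<Rightarrow> ('g set \<Rightarrow> 'x \<Rightarrow> 'x)
      \<Rightarrow> (('g, 'x) L_elem \<Rightarrow> ('g, 'x) L_elem \<Rightarrow> complex)
      \<Rightarrow> ('g, 'x) L_elem \<Rightarrow> ('g, 'x) L_elem \<Rightarrow> complex" where
  "averaged_form G M \<phi> H U \<rho> b v w =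
     (\<Sum>C\<in>carrier (normalizer_quotient G H).
        b (L_action G M \<phi> H U \<rho> (fp_class G M \<phi> C) v) (L_action G M \<phi> H U \<rho> (fp_class G M \<phi> C) w))"

text \<open>The value of the form on \<open>v \<in> V\<^sub>i\<close> and \<open>w \<in> V\<^sub>j\<close>; \<open>gs\<close> is the choice of conjugating
  elements.\<close>

definition component_form ::
    "('g, 'z) monoid_scheme \<Rightarrow> 'm set \<Rightarrow> ('g \<Rightarrow> 'm \<Rightarrow> 'm) \<Rightarrow> 'g set
      \<Rightarrow> (complex, 'x) module \<Rightarrow> ('g set \<Rightarrow> 'x \<Rightarrow> 'x) \<Rightarrow> (nat \<Rightarrow> 'g)
      \<Rightarrow> (('g, 'x) L_elem \<Rightarrow> ('g, 'x) L_elem \<Rightarrow> complex)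
      \<Rightarrow> nat \<Rightarrow> nat \<Rightarrow> ('g, 'x) L_elem \<Rightarrow> ('g, 'x) L_elem \<Rightarrow> complex" where
  "component_form G M \<phi> H U \<rho> gs b i j v w =
     (if i = j then
        averaged_form G M \<phi> H U \<rho> b
          (L_action G M \<phi> H U \<rho> (fp_class G M \<phi> {gs i}) v)
          (L_action G M \<phi> H U \<rho> (fp_class G M \<phi> {gs j}) w)
      else 0)"

text \<open>Sesquilinear extension along the decomposition of \<open>L(H, U)\<close> into the images of the
  idempotents of the conjugates \<open>Hs\<close> of \<open>H\<close>.\<close>

definition L_form ::
    "('g, 'z) monoid_scheme \<Rightarrow> 'm set \<Rightarrow> ('g \<Rightarrow> 'm \<Rightarrow> 'm) \<Rightarrow> 'g set
      \<Rightarrow> (complex, 'x) module \<Rightarrow> ('g set \<Rightarrow> 'x \<Rightarrow> 'x) \<Rightarrow> 'g set list \<Rightarrow> (nat \<Rightarrow> 'g)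
      \<Rightarrow> (('g, 'x) L_elem \<Rightarrow> ('g, 'x) L_elem \<Rightarrow> complex)
      \<Rightarrow> ('g, 'x) L_elem \<Rightarrow> ('g, 'x) L_elem \<Rightarrow> complex" where
  "L_form G M \<phi> H U \<rho> Hs gs b v w =
     (let comps = components (L_module G M \<phi> H U \<rho>) (length Hs)
                    (\<lambda>i. idem_image G M \<phi> H U \<rho> (Hs ! i))
      in \<Sum>i<length Hs. \<Sum>j<length Hs.
           component_form G M \<phi> H U \<rho> gs b i j (comps v i) (comps w j))"

end

theory Submission
  imports Defs
begin

text \<open>By orbit-maximality the \<open>\<L>\<close>-class of \<open>H\<close> consists of the classes of the cosets \<open>g H\<close>, and the
  class of \<open>S\<close> sends \<open>g H \<otimes> x\<close> to \<open>g' H \<otimes> x\<close> if \<open>S g H \<subseteq> g' H\<close> and to zero if there is no such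
  \<open>g'\<close>. Hence the idempotents of the conjugates \<open>H\<^sub>i\<close> act as orthogonal projections with sum 1, and
  with \<open>p\<^sub>i v = H g\<^sub>i v \<in> V\<^sub>1\<close> the form is \<open>(v, w) = \<Sum>\<^sub>i \<beta> (p\<^sub>i v) (p\<^sub>i w)\<close>, where \<open>\<beta>\<close> is the averaged
  form on \<open>V\<^sub>1\<close>. Moreover \<open>p\<^sub>j (S v) = \<Sum>\<^sub>i D\<^sub>j\<^sub>i (p\<^sub>i v)\<close> with \<open>D\<^sub>j\<^sub>i = H g\<^sub>j S g\<^sub>i\<inverse> H\<close>, and replacing \<open>S\<close> by
  \<open>S\<inverse>\<close> inverts and transposes this matrix. So it suffices that \<open>\<beta> (D v) w = \<beta> v (D\<inverse> w)\<close> for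
  \<open>D = H D H\<close>: such a \<open>D\<close> either annihilates \<open>L(H, U)\<close> or is a coset of \<open>H\<close> in its normalizer, and
  \<open>\<beta>\<close> is invariant under the normalizer.\<close>

section \<open>Formal spans\<close>

text \<open>The action on V_H is truncated: a product that leaves the \<L>-class becomes zero. So
  every identity between operators has to match the vanishing cases as well as the values, and this
  is awkward for classes, which forget the subset they come from. Orbit-maximality removes the
  obstacle: every representative of the class of gH lies in gH (\<open>cl_eq_coset_subset\<close>).
  Non-vanishing thus becomes an inclusion between subsets of G, and products, inverses and vanishing
  can all be followed on subsets. The tensor product is a quotient of a formal span on all pairs of
  vectors, and instead of choosing a basis the operators are compared on the spanning tensors gH
  \<otimes> x. Definiteness of the form comes from the fact that the coordinates p_i v determine v:
  the component of v in V_i is g_i^-1 p_i v. Finiteness of G enters where one-sided inclusions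
  between conjugates of H have to become equalities.\<close>

lemma complex_ring_simps [simp]:
  "carrier complex_ring = UNIV"
  "x \<oplus>\<^bsub>complex_ring\<^esub> y = x + y"
  "x \<otimes>\<^bsub>complex_ring\<^esub> y = x * y"
  "\<one>\<^bsub>complex_ring\<^esub> = 1"
  "\<zero>\<^bsub>complex_ring\<^esub> = 0"
  by (simp_all add: ring_of_type_algebra_def)

lemma formal_span_simps [simp]:
  "\<zero>\<^bsub>formal_span B\<^esub> = (\<lambda>_. 0)"
  "f \<oplus>\<^bsub>formal_span B\<^esub> h = (\<lambda>x. f x + h x)"
  "c \<odot>\<^bsub>formal_span B\<^esub> f = (\<lambda>x. c * f x)"
  by (simp_all add: formal_span_def)

lemma carrier_formal_span:
  "f \<in> carrier (formal_span B) \<longleftrightarrow> finite {x. f x \<noteq> 0} \<and> {x. f x \<noteq> 0} \<subseteq> B"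
  by (simp add: formal_span_def)

lemma formal_span_zero [simp]: "(\<lambda>_. 0) \<in> carrier (formal_span B)"
  by (simp add: carrier_formal_span)

lemma formal_span_add:
  assumes "f \<in> carrier (formal_span B)" "h \<in> carrier (formal_span B)"
  shows "(\<lambda>x. f x + h x) \<in> carrier (formal_span B)"
proof -
  have "{x. f x + h x \<noteq> 0} \<subseteq> {x. f x \<noteq> 0} \<union> {x. h x \<noteq> 0}" by auto
  then show ?thesis using assms unfolding carrier_formal_span
    by (meson finite_Un finite_subset le_sup_iff order_trans)
qed

lemma formal_span_smult:
  assumes "f \<in> carrier (formal_span B)"
  shows "(\<lambda>x. c * f x) \<in> carrier (formal_span B)"
proof -
  have "{x. c * f x \<noteq> 0} \<subseteq> {x. f x \<noteq> 0}" by auto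
  then show ?thesis using assms unfolding carrier_formal_span
    by (meson finite_subset order_trans)
qed

lemma single_vec_closed [simp]: "b \<in> B \<Longrightarrow> single_vec b \<in> carrier (formal_span B)"
  by (auto simp: carrier_formal_span single_vec_def)

lemma module_formal_span: "module complex_ring (formal_span B)"
proof (rule moduleI)
  show "cring complex_ring" ..
  show "abelian_group (formal_span B)"
  proof (rule abelian_groupI)
    fix f assume "f \<in> carrier (formal_span B)"
    then have "(\<lambda>x. -1 * f x) \<in> carrier (formal_span B)" by (rule formal_span_smult)
    then show "\<exists>h\<in>carrier (formal_span B). h \<oplus>\<^bsub>formal_span B\<^esub> f = \<zero>\<^bsub>formal_span B\<^esub>"
      by (rule bexI[rotated]) simp
  qed (auto simp: formal_span_add algebra_simps)
qed (auto simp: formal_span_smult algebra_simps)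

lemma formal_span_a_inv:
  assumes "f \<in> carrier (formal_span B)"
  shows "\<ominus>\<^bsub>formal_span B\<^esub> f = (\<lambda>x. - f x)"
proof -
  interpret module complex_ring "formal_span B" by (rule module_formal_span)
  show ?thesis
    using formal_span_smult[OF assms, of "-1"] assms by (intro M.minus_equality) auto
qed

lemma formal_span_minus:
  assumes "h \<in> carrier (formal_span B)"
  shows "f \<ominus>\<^bsub>formal_span B\<^esub> h = (\<lambda>x. f x - h x)"
  by (simp add: a_minus_def formal_span_a_inv[OF assms])

text \<open>Induction on a finite set containing the support, clearing the coefficient at one point
  at a time. It reduces linear statements to basis vectors, both for V_H and for the span underlying
  the tensor product.\<close>

lemma formal_span_induct [consumes 1, case_names zero step]:
  assumes "f \<in> carrier (formal_span B)"
    and "P (\<lambda>_. 0)"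
    and step: "\<And>b c f. b \<in> B \<Longrightarrow> f \<in> carrier (formal_span B) \<Longrightarrow> P f \<Longrightarrow>
      P (\<lambda>x. c * single_vec b x + f x)"
  shows "P f"
proof -
  have "finite A \<Longrightarrow> A \<subseteq> B \<Longrightarrow> {x. f x \<noteq> 0} \<subseteq> A \<Longrightarrow> P f" for A f
  proof (induction A arbitrary: f rule: finite_induct)
    case empty
    then have "f = (\<lambda>_. 0)" by auto
    then show ?case using assms(2) by simp
  next
    case (insert a A)
    define f' where "f' = f(a := 0)"
    have sub: "{x. f' x \<noteq> 0} \<subseteq> A" using insert.prems by (auto simp: f'_def)
    then have "finite {x. f' x \<noteq> 0}" using insert.hyps(1) by (rule finite_subset)
    then have "f' \<in> carrier (formal_span B)"
      using sub insert.prems by (auto simp: carrier_formal_span)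
    moreover have "P f'" using insert.IH insert.prems sub by auto
    moreover have "f = (\<lambda>x. f a * single_vec a x + f' x)"
      by (auto simp: f'_def single_vec_def)
    ultimately show ?case using step[of a f' "f a"] insert.prems by auto
  qed
  then show ?thesis using assms(1) unfolding carrier_formal_span by blast
qed

text \<open>The sum in \<open>lin_ext\<close> runs over the support of its argument, which varies
  with the argument. A common finite superset gives several such sums the same index set.\<close>

lemma lin_ext_superset:
  assumes "finite S" "{x. f x \<noteq> 0} \<subseteq> S"
  shows "lin_ext h f y = (\<Sum>x\<in>S. f x * h x y)"
  unfolding lin_ext_def using assms by (intro sum.mono_neutral_left) auto

lemma lin_ext_zero [simp]: "lin_ext h (\<lambda>_. 0) = (\<lambda>_. 0)"
  by (simp add: lin_ext_def)

lemma lin_ext_single [simp]: "lin_ext h (single_vec b) = h b"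
  by (rule ext, subst lin_ext_superset[of "{b}"]) (auto simp: single_vec_def)

lemma lin_ext_add:
  assumes "f \<in> carrier (formal_span B)" "g \<in> carrier (formal_span B)"
  shows "lin_ext h (\<lambda>x. f x + g x) = (\<lambda>y. lin_ext h f y + lin_ext h g y)"
proof
  fix y
  let ?S = "{x. f x \<noteq> 0} \<union> {x. g x \<noteq> 0}"
  have fin: "finite ?S" using assms by (simp add: carrier_formal_span)
  have "lin_ext h (\<lambda>x. f x + g x) y = (\<Sum>x\<in>?S. (f x + g x) * h x y)"
    "lin_ext h f y = (\<Sum>x\<in>?S. f x * h x y)" "lin_ext h g y = (\<Sum>x\<in>?S. g x * h x y)"
    by (rule lin_ext_superset[OF fin]; auto)+
  then show "lin_ext h (\<lambda>x. f x + g x) y = lin_ext h f y + lin_ext h g y"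
    by (simp add: sum.distrib algebra_simps)
qed

lemma lin_ext_smult:
  assumes "f \<in> carrier (formal_span B)"
  shows "lin_ext h (\<lambda>x. c * f x) = (\<lambda>y. c * lin_ext h f y)"
proof
  fix y
  have fin: "finite {x. f x \<noteq> 0}" using assms by (simp add: carrier_formal_span)
  have "lin_ext h (\<lambda>x. c * f x) y = (\<Sum>x | f x \<noteq> 0. (c * f x) * h x y)"
    by (rule lin_ext_superset[OF fin]) auto
  then show "lin_ext h (\<lambda>x. c * f x) y = c * lin_ext h f y"
    by (simp add: lin_ext_def sum_distrib_left algebra_simps)
qed

lemma lin_ext_closed:
  assumes "f \<in> carrier (formal_span B)" "\<And>b. b \<in> B \<Longrightarrow> h b \<in> carrier (formal_span C)"
  shows "lin_ext h f \<in> carrier (formal_span C)"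
  using assms(1)
proof (induction rule: formal_span_induct)
  case (step b c f)
  have "lin_ext h (\<lambda>x. c * single_vec b x + f x) = (\<lambda>y. c * h b y + lin_ext h f y)"
    using step by (simp add: lin_ext_add[OF formal_span_smult[OF single_vec_closed]] lin_ext_smult[OF single_vec_closed[of b B]])
  then show ?case using step assms(2) by (simp add: formal_span_add formal_span_smult)
qed simp

section \<open>Quotients and tensor products\<close>

locale quotient_space = F?: module complex_ring F + submodule W complex_ring F
  for F :: "(complex, 'v) module" (structure) and W
begin

abbreviation "cls f \<equiv> W +> f"
abbreviation "Q \<equiv> quotient_module F W"

sublocale W: abelian_subgroup W F
  by (rule abelian_subgroupI3)
    (auto intro: additive_subgroup.intro subgroup_axioms F.M.abelian_group_axioms)

lemma carrier_quotient: "carrier Q = cls ` carrier F"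
  by (auto simp: quotient_module_def A_RCOSETS_def')

lemma cls_closed [simp]: "f \<in> carrier F \<Longrightarrow> cls f \<in> carrier Q"
  by (simp add: carrier_quotient)

lemma cls_add:
  "f \<in> carrier F \<Longrightarrow> h \<in> carrier F \<Longrightarrow> cls f \<oplus>\<^bsub>Q\<^esub> cls h = cls (f \<oplus> h)"
  by (simp add: quotient_module_def W.a_rcos_sum)

lemma cls_zero: "\<zero>\<^bsub>Q\<^esub> = cls \<zero>"
  by (simp add: quotient_module_def W.a_subset)

lemma abelian_group_quotient: "abelian_group Q"
proof (rule abelian_groupI)
  fix x assume "x \<in> carrier Q"
  then obtain f where f: "f \<in> carrier F" "x = cls f" by (auto simp: carrier_quotient)
  then have "cls (\<ominus> f) \<oplus>\<^bsub>Q\<^esub> x = \<zero>\<^bsub>Q\<^esub>" by (simp add: cls_add cls_zero F.M.l_neg)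
  then show "\<exists>y\<in>carrier Q. y \<oplus>\<^bsub>Q\<^esub> x = \<zero>\<^bsub>Q\<^esub>" using f by (auto simp: carrier_quotient)
qed (auto simp: carrier_quotient cls_add cls_zero F.M.a_ac)

lemma cls_eqI:
  "f \<in> carrier F \<Longrightarrow> h \<in> carrier F \<Longrightarrow> f \<ominus> h \<in> W \<Longrightarrow> cls f = cls h"
  by (metis W.a_rcos_module_rev W.a_repr_independence' a_minus_def W.is_abelian_subgroup)

lemma mem_clsE:
  assumes "h \<in> cls f" "f \<in> carrier F"
  obtains "h \<in> carrier F" "h \<ominus> f \<in> W"
proof -
  obtain w where w: "w \<in> W" "h = w \<oplus> f" using assms(1) by (auto simp: a_r_coset_def')
  then have "w \<in> carrier F" using W.a_subset by blast
  then have "h \<ominus> f = w" using w assms(2) by (simp add: a_minus_def F.M.a_assoc F.M.r_neg)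
  then show thesis using that w \<open>w \<in> carrier F\<close> assms(2) by auto
qed

text \<open>Operations on cosets are encoded as unions over representatives. Such a union collapses
  to one coset when \<open>t\<close> keeps differences inside \<open>W\<close>; scalar
  multiplication and \<open>tensor_left\<close> are both instances.\<close>

lemma UN_cls:
  assumes "f \<in> carrier F"
    and "\<And>h. h \<in> carrier F \<Longrightarrow> t h \<in> carrier F"
    and "\<And>h. h \<in> carrier F \<Longrightarrow> h \<ominus> f \<in> W \<Longrightarrow> t h \<ominus> t f \<in> W"
  shows "(\<Union>h\<in>cls f. cls (t h)) = cls (t f)"
proof -
  have "cls (t h) = cls (t f)" if "h \<in> cls f" for h
    using mem_clsE[OF that assms(1)] assms by (meson cls_eqI)
  moreover have "f \<in> cls f" by (simp add: W.a_rcos_self assms(1))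
  ultimately show ?thesis by blast
qed

lemma smult_minus:
  assumes "h \<in> carrier F" "f \<in> carrier F"
  shows "c \<odot> h \<ominus> c \<odot> f = c \<odot> (h \<ominus> f)"
  using assms by (simp add: a_minus_def F.smult_r_distr F.smult_r_minus)

lemma cls_smult: "f \<in> carrier F \<Longrightarrow> c \<odot>\<^bsub>Q\<^esub> cls f = cls (c \<odot> f)"
  unfolding quotient_module_def
  by (simp, rule UN_cls) (auto simp: smult_minus)

end

text \<open>The hull is the intersection of all submodules containing \<open>S\<close>. The closure
  properties pass to intersections, and the carrier is itself a member of the family, which keeps
  the intersection inside it.\<close>

lemma submodule_hull:
  assumes "module R M" "S \<subseteq> carrier M"
  shows "submodule ((\<lambda>W. submodule W R M) hull S) R M"
proof -
  interpret module R M by fact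
  let ?\<S> = "{W. submodule W R M \<and> S \<subseteq> W}"
  note sub = submoduleE
  have "submodule (\<Inter>?\<S>) R M"
  proof (rule submoduleI)
    show "\<Inter>?\<S> \<subseteq> carrier M"
      using carrier_is_submodule assms(2) by (intro Inter_lower) simp
    have "\<zero>\<^bsub>M\<^esub> \<in> Y" if "submodule Y R M" for Y
      using subgroup.one_closed[OF submodule.axioms(1)[OF that]] by simp
    then show "\<zero>\<^bsub>M\<^esub> \<in> \<Inter>?\<S>" by blast
  next
    fix f assume "f \<in> \<Inter>?\<S>"
    then show "\<ominus>\<^bsub>M\<^esub> f \<in> \<Inter>?\<S>" using sub(3) by blast
  next
    fix f h assume "f \<in> \<Inter>?\<S>" "h \<in> \<Inter>?\<S>"
    then show "f \<oplus>\<^bsub>M\<^esub> h \<in> \<Inter>?\<S>" using sub(5)[of _ f h] by auto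
  next
    fix c f assume "c \<in> carrier R" "f \<in> \<Inter>?\<S>"
    then show "c \<odot>\<^bsub>M\<^esub> f \<in> \<Inter>?\<S>" using sub(4)[of _ c f] by auto
  qed
  then show ?thesis by (simp add: hull_def)
qed

section \<open>Balanced tensor products\<close>

locale tensor =
  fixes I :: "'q set" and V :: "(complex, 'v) module" and r :: "'q \<Rightarrow> 'v \<Rightarrow> 'v"
    and U :: "(complex, 'x) module" and \<rho> :: "'q \<Rightarrow> 'x \<Rightarrow> 'x"
  assumes V: "module complex_ring V" and U: "module complex_ring U"
    and r_closed: "q \<in> I \<Longrightarrow> v \<in> carrier V \<Longrightarrow> r q v \<in> carrier V"
    and \<rho>_closed: "q \<in> I \<Longrightarrow> x \<in> carrier U \<Longrightarrow> \<rho> q x \<in> carrier U"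
begin

abbreviation "F \<equiv> formal_span (carrier V \<times> carrier U)"
abbreviation "W \<equiv> tensor_kernel I V r U \<rho>"
abbreviation "T \<equiv> tensor_product I V r U \<rho>"
abbreviation "tens v x \<equiv> W +>\<^bsub>F\<^esub> single_vec (v, x)"

sublocale V: module complex_ring V by (rule V)
sublocale U: module complex_ring U by (rule U)

lemma tensor_relationsE:
  assumes "f \<in> tensor_relations I V r U \<rho>"
  obtains
    (add_left) v v' x where "v \<in> carrier V" "v' \<in> carrier V" "x \<in> carrier U"
      "f = single_vec (v \<oplus>\<^bsub>V\<^esub> v', x) \<ominus>\<^bsub>F\<^esub> (single_vec (v, x) \<oplus>\<^bsub>F\<^esub> single_vec (v', x))"
  | (add_right) v x x' where "v \<in> carrier V" "x \<in> carrier U" "x' \<in> carrier U"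
      "f = single_vec (v, x \<oplus>\<^bsub>U\<^esub> x') \<ominus>\<^bsub>F\<^esub> (single_vec (v, x) \<oplus>\<^bsub>F\<^esub> single_vec (v, x'))"
  | (smult_left) c v x where "v \<in> carrier V" "x \<in> carrier U"
      "f = single_vec (c \<odot>\<^bsub>V\<^esub> v, x) \<ominus>\<^bsub>F\<^esub> c \<odot>\<^bsub>F\<^esub> single_vec (v, x)"
  | (smult_right) c v x where "v \<in> carrier V" "x \<in> carrier U"
      "f = single_vec (v, c \<odot>\<^bsub>U\<^esub> x) \<ominus>\<^bsub>F\<^esub> c \<odot>\<^bsub>F\<^esub> single_vec (v, x)"
  | (balanced) q v x where "q \<in> I" "v \<in> carrier V" "x \<in> carrier U"
      "f = single_vec (r q v, x) \<ominus>\<^bsub>F\<^esub> single_vec (v, \<rho> q x)"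
  using assms unfolding tensor_relations_def Let_def
  apply (elim UnE CollectE exE conjE)
      apply (rule add_left; assumption)
     apply (rule add_right; assumption)
    apply (rule smult_left; assumption)
   apply (rule smult_right; assumption)
  apply (rule balanced; assumption)
  done

lemma tensor_relation_add_left:
  "v \<in> carrier V \<Longrightarrow> v' \<in> carrier V \<Longrightarrow> x \<in> carrier U \<Longrightarrow>
    single_vec (v \<oplus>\<^bsub>V\<^esub> v', x) \<ominus>\<^bsub>F\<^esub> (single_vec (v, x) \<oplus>\<^bsub>F\<^esub> single_vec (v', x))
      \<in> tensor_relations I V r U \<rho>"
  unfolding tensor_relations_def Let_def by (rule UnI1, rule UnI1, rule UnI1, rule UnI1, blast)

lemma tensor_relation_add_right:
  "v \<in> carrier V \<Longrightarrow> x \<in> carrier U \<Longrightarrow> x' \<in> carrier U \<Longrightarrow>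
    single_vec (v, x \<oplus>\<^bsub>U\<^esub> x') \<ominus>\<^bsub>F\<^esub> (single_vec (v, x) \<oplus>\<^bsub>F\<^esub> single_vec (v, x'))
      \<in> tensor_relations I V r U \<rho>"
  unfolding tensor_relations_def Let_def by (rule UnI1, rule UnI1, rule UnI1, rule UnI2, blast)

lemma tensor_relation_smult_left:
  "v \<in> carrier V \<Longrightarrow> x \<in> carrier U \<Longrightarrow>
    single_vec (c \<odot>\<^bsub>V\<^esub> v, x) \<ominus>\<^bsub>F\<^esub> c \<odot>\<^bsub>F\<^esub> single_vec (v, x) \<in> tensor_relations I V r U \<rho>"
  unfolding tensor_relations_def Let_def by (rule UnI1, rule UnI1, rule UnI2, blast)

lemma tensor_relation_smult_right:
  "v \<in> carrier V \<Longrightarrow> x \<in> carrier U \<Longrightarrow>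
    single_vec (v, c \<odot>\<^bsub>U\<^esub> x) \<ominus>\<^bsub>F\<^esub> c \<odot>\<^bsub>F\<^esub> single_vec (v, x) \<in> tensor_relations I V r U \<rho>"
  unfolding tensor_relations_def Let_def by (rule UnI1, rule UnI2, blast)

lemma tensor_relation_balanced:
  "q \<in> I \<Longrightarrow> v \<in> carrier V \<Longrightarrow> x \<in> carrier U \<Longrightarrow>
    single_vec (r q v, x) \<ominus>\<^bsub>F\<^esub> single_vec (v, \<rho> q x) \<in> tensor_relations I V r U \<rho>"
  unfolding tensor_relations_def Let_def by (rule UnI2, blast)

lemmas tensor_relationsI =
  tensor_relation_add_left tensor_relation_add_right tensor_relation_smult_left
  tensor_relation_smult_right tensor_relation_balanced

lemma tensor_relations_subset: "tensor_relations I V r U \<rho> \<subseteq> carrier F"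
proof
  interpret F: module complex_ring F by (rule module_formal_span)
  fix f assume "f \<in> tensor_relations I V r U \<rho>"
  then show "f \<in> carrier F"
  proof (cases rule: tensor_relationsE)
    case (add_left v v' x)
    then show ?thesis by (simp del: formal_span_simps)
  next
    case (add_right v x x')
    then show ?thesis by (simp del: formal_span_simps)
  next
    case (smult_left c v x)
    then show ?thesis by (simp del: formal_span_simps)
  next
    case (smult_right c v x)
    then show ?thesis by (simp del: formal_span_simps)
  next
    case (balanced q v x)
    then show ?thesis by (simp del: formal_span_simps add: r_closed \<rho>_closed)
  qed
qed

lemma submodule_tensor_kernel: "submodule W complex_ring F"
  unfolding tensor_kernel_def
  by (rule submodule_hull[OF module_formal_span tensor_relations_subset])

sublocale quotient_space F W
  by (intro quotient_space.intro module_formal_span submodule_tensor_kernel)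

lemma T_eq: "T = quotient_module F W"
  by (simp add: tensor_product_def)

sublocale T: abelian_group T
  unfolding T_eq by (rule abelian_group_quotient)

lemma tens_closed: "v \<in> carrier V \<Longrightarrow> x \<in> carrier U \<Longrightarrow> tens v x \<in> carrier T"
  by (simp add: T_eq)

lemma tensor_relations_kernel: "f \<in> tensor_relations I V r U \<rho> \<Longrightarrow> f \<in> W"
  unfolding tensor_kernel_def by (rule hull_inc)

lemma tens_add_left:
  assumes "v \<in> carrier V" "v' \<in> carrier V" "x \<in> carrier U"
  shows "tens (v \<oplus>\<^bsub>V\<^esub> v') x = tens v x \<oplus>\<^bsub>T\<^esub> tens v' x"
  unfolding T_eq using assms
  by (simp add: cls_add del: formal_span_simps)
    (intro cls_eqI tensor_relations_kernel tensor_relationsI F.M.a_closed; simp)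

lemma tens_smult_left:
  assumes "v \<in> carrier V" "x \<in> carrier U"
  shows "tens (c \<odot>\<^bsub>V\<^esub> v) x = c \<odot>\<^bsub>T\<^esub> tens v x"
  unfolding T_eq using assms
  by (simp add: cls_smult del: formal_span_simps)
    (intro cls_eqI tensor_relations_kernel tensor_relationsI F.smult_closed; simp)

lemma tens_smult_right:
  assumes "v \<in> carrier V" "x \<in> carrier U"
  shows "tens v (c \<odot>\<^bsub>U\<^esub> x) = c \<odot>\<^bsub>T\<^esub> tens v x"
  unfolding T_eq using assms
  by (simp add: cls_smult del: formal_span_simps)
    (intro cls_eqI tensor_relations_kernel tensor_relationsI F.smult_closed; simp)

text \<open>By additivity the tensor with zero equals its own double; cancel one copy.\<close>

lemma tens_zero_left: "x \<in> carrier U \<Longrightarrow> tens \<zero>\<^bsub>V\<^esub> x = \<zero>\<^bsub>T\<^esub>"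
  using tens_add_left[of "\<zero>\<^bsub>V\<^esub>" "\<zero>\<^bsub>V\<^esub>" x] tens_closed[of "\<zero>\<^bsub>V\<^esub>" x]
  by (metis T.add.r_cancel_one' V.zero_closed V.r_zero)

text \<open>A coefficient is absorbed into the right factor, c (v \<otimes> x) = v \<otimes> c x, so
  that sums of pure tensors exhaust \<open>T\<close> and the step carries no scalar.\<close>

lemma tensor_induct [consumes 1, case_names zero step]:
  assumes "u \<in> carrier T"
    and "P \<zero>\<^bsub>T\<^esub>"
    and step: "\<And>v x u. v \<in> carrier V \<Longrightarrow> x \<in> carrier U \<Longrightarrow> u \<in> carrier T \<Longrightarrow> P u \<Longrightarrow>
      P (tens v x \<oplus>\<^bsub>T\<^esub> u)"
  shows "P u"
proof -
  obtain f where f: "f \<in> carrier F" "u = cls f" using assms(1) by (auto simp: T_eq carrier_quotient)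
  from f(1) have "P (cls f)"
  proof (induction rule: formal_span_induct)
    case zero
    then show ?case using assms(2) by (simp add: T_eq cls_zero)
  next
    case (step b c f)
    obtain v x where b: "b = (v, x)" "v \<in> carrier V" "x \<in> carrier U" using step.hyps by auto
    have "cls (\<lambda>y. c * single_vec b y + f y) = tens v (c \<odot>\<^bsub>U\<^esub> x) \<oplus>\<^bsub>T\<^esub> cls f"
      using b step.hyps cls_add[of "c \<odot>\<^bsub>F\<^esub> single_vec b" f] cls_smult[of "single_vec b" c]
      by (simp add: tens_smult_right T_eq formal_span_smult)
    then show ?case using assms(3)[of v "c \<odot>\<^bsub>U\<^esub> x" "cls f"] b step by (simp add: T_eq)
  qed
  then show ?thesis using f by simp
qed

end

section \<open>Endomorphisms of a tensor product induced from the left factor\<close>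

locale tensor_endo = tensor +
  fixes t
  assumes t_closed: "v \<in> carrier V \<Longrightarrow> t v \<in> carrier V"
    and t_add: "v \<in> carrier V \<Longrightarrow> w \<in> carrier V \<Longrightarrow> t (v \<oplus>\<^bsub>V\<^esub> w) = t v \<oplus>\<^bsub>V\<^esub> t w"
    and t_smult: "v \<in> carrier V \<Longrightarrow> t (c \<odot>\<^bsub>V\<^esub> v) = c \<odot>\<^bsub>V\<^esub> t v"
    and t_r: "q \<in> I \<Longrightarrow> v \<in> carrier V \<Longrightarrow> t (r q v) = r q (t v)"
begin

abbreviation "lift \<equiv> lin_ext (\<lambda>(v, x). single_vec (t v, x))"

lemma lift_closed: "f \<in> carrier F \<Longrightarrow> lift f \<in> carrier F"
  by (rule lin_ext_closed) (auto simp: t_closed)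

lemma lift_add: "f \<in> carrier F \<Longrightarrow> h \<in> carrier F \<Longrightarrow> lift (f \<oplus>\<^bsub>F\<^esub> h) = lift f \<oplus>\<^bsub>F\<^esub> lift h"
  by (simp add: lin_ext_add[of _ "carrier V \<times> carrier U"])

lemma lift_smult: "f \<in> carrier F \<Longrightarrow> lift (c \<odot>\<^bsub>F\<^esub> f) = c \<odot>\<^bsub>F\<^esub> lift f"
  by (simp add: lin_ext_smult[of _ "carrier V \<times> carrier U"])

lemma lift_minus:
  assumes "f \<in> carrier F" "h \<in> carrier F"
  shows "lift (f \<ominus>\<^bsub>F\<^esub> h) = lift f \<ominus>\<^bsub>F\<^esub> lift h"
proof -
  have "f \<ominus>\<^bsub>F\<^esub> h = f \<oplus>\<^bsub>F\<^esub> (-1) \<odot>\<^bsub>F\<^esub> h" using assms by (simp add: formal_span_minus)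
  then have "lift (f \<ominus>\<^bsub>F\<^esub> h) = lift f \<oplus>\<^bsub>F\<^esub> (-1) \<odot>\<^bsub>F\<^esub> lift h"
    using assms by (simp add: lift_add lift_smult del: formal_span_simps)
  then show ?thesis using assms by (simp add: formal_span_minus lift_closed)
qed

lemma lift_single: "lift (single_vec (v, x)) = single_vec (t v, x)"
  by simp

lemma lift_relations:
  assumes "f \<in> tensor_relations I V r U \<rho>"
  shows "lift f \<in> tensor_relations I V r U \<rho>"
  using assms
proof (cases rule: tensor_relationsE)
  case (add_left v v' x)
  have "lift f = single_vec (t v \<oplus>\<^bsub>V\<^esub> t v', x) \<ominus>\<^bsub>F\<^esub> (single_vec (t v, x) \<oplus>\<^bsub>F\<^esub> single_vec (t v', x))"
    using add_left by (simp add: lift_minus lift_add lift_single t_add del: formal_span_simps lin_ext_single)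
  then show ?thesis using add_left by (simp only: tensor_relation_add_left t_closed)
next
  case (add_right v x x')
  have "lift f = single_vec (t v, x \<oplus>\<^bsub>U\<^esub> x') \<ominus>\<^bsub>F\<^esub> (single_vec (t v, x) \<oplus>\<^bsub>F\<^esub> single_vec (t v, x'))"
    using add_right by (simp add: lift_minus lift_add lift_single del: formal_span_simps lin_ext_single)
  then show ?thesis using add_right by (simp only: tensor_relation_add_right t_closed)
next
  case (smult_left c v x)
  have "lift f = single_vec (c \<odot>\<^bsub>V\<^esub> t v, x) \<ominus>\<^bsub>F\<^esub> c \<odot>\<^bsub>F\<^esub> single_vec (t v, x)"
    using smult_left
    by (simp add: lift_minus lift_smult lift_single t_smult del: formal_span_simps lin_ext_single)
  then show ?thesis using smult_left by (simp only: tensor_relation_smult_left t_closed)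
next
  case (smult_right c v x)
  have "lift f = single_vec (t v, c \<odot>\<^bsub>U\<^esub> x) \<ominus>\<^bsub>F\<^esub> c \<odot>\<^bsub>F\<^esub> single_vec (t v, x)"
    using smult_right
    by (simp add: lift_minus lift_smult lift_single del: formal_span_simps lin_ext_single)
  then show ?thesis using smult_right by (simp only: tensor_relation_smult_right t_closed)
next
  \<comment> \<open>The relation v q \<otimes> x = v \<otimes> q x is preserved because
    \<open>t\<close> commutes with the right action (\<open>t_r\<close>).\<close>
  case (balanced q v x)
  have "lift f = single_vec (r q (t v), x) \<ominus>\<^bsub>F\<^esub> single_vec (t v, \<rho> q x)"
    using balanced
    by (simp add: lift_minus lift_single t_r r_closed \<rho>_closed del: formal_span_simps lin_ext_single)
  then show ?thesis using balanced by (simp only: tensor_relation_balanced t_closed)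
qed

text \<open>The elements that \<open>lift\<close> sends into \<open>W\<close> form a submodule, and
  it contains the relations because \<open>lift\<close> permits no relation to leave their set.
  Minimality of the hull then puts all of \<open>W\<close> inside.\<close>

lemma lift_kernel:
  assumes "f \<in> W"
  shows "lift f \<in> W"
proof -
  let ?K = "{f \<in> carrier F. lift f \<in> W}"
  note sub = F.submoduleE[OF submodule_tensor_kernel]
  have "submodule ?K complex_ring F"
  proof (rule F.submoduleI)
    show "?K \<subseteq> carrier F" by blast
    show "\<zero>\<^bsub>F\<^esub> \<in> ?K" using W.zero_closed by simp
  next
    fix f assume f: "f \<in> ?K"
    then have "lift (\<ominus>\<^bsub>F\<^esub> f) = \<ominus>\<^bsub>F\<^esub> lift f"
      using lift_smult[of f "-1"] by (simp add: formal_span_a_inv lift_closed)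
    then show "\<ominus>\<^bsub>F\<^esub> f \<in> ?K" using f sub(3) by (simp del: formal_span_simps)
  next
    fix f h assume "f \<in> ?K" "h \<in> ?K"
    then show "f \<oplus>\<^bsub>F\<^esub> h \<in> ?K" by (simp add: lift_add sub(5) del: formal_span_simps)
  next
    fix c f assume "f \<in> ?K"
    then show "c \<odot>\<^bsub>F\<^esub> f \<in> ?K" by (simp add: lift_smult sub(4) del: formal_span_simps)
  qed
  moreover have "tensor_relations I V r U \<rho> \<subseteq> ?K"
    using tensor_relations_subset lift_relations tensor_relations_kernel by blast
  ultimately have "W \<subseteq> ?K" unfolding tensor_kernel_def by (intro hull_minimal)
  then show ?thesis using assms by blast
qed

abbreviation "t_op \<equiv> tensor_left I V r U \<rho> t"

lemma tensor_left_cls: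
  assumes "f \<in> carrier F"
  shows "t_op (cls f) = cls (lift f)"
  unfolding tensor_left_def
  using assms by (intro UN_cls) (auto simp: lift_closed lift_minus[symmetric] lift_kernel)

lemma tensor_left_closed: "u \<in> carrier T \<Longrightarrow> t_op u \<in> carrier T"
  by (auto simp: T_eq carrier_quotient tensor_left_cls lift_closed)

lemma tensor_left_add:
  "u \<in> carrier T \<Longrightarrow> u' \<in> carrier T \<Longrightarrow> t_op (u \<oplus>\<^bsub>T\<^esub> u') = t_op u \<oplus>\<^bsub>T\<^esub> t_op u'"
  by (auto simp: T_eq carrier_quotient tensor_left_cls lift_closed cls_add lift_add
      simp del: formal_span_simps)

lemma tensor_left_smult: "u \<in> carrier T \<Longrightarrow> t_op (c \<odot>\<^bsub>T\<^esub> u) = c \<odot>\<^bsub>T\<^esub> t_op u"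
  by (auto simp: T_eq carrier_quotient tensor_left_cls lift_closed cls_smult lift_smult
      simp del: formal_span_simps)

lemma tensor_left_tens:
  "v \<in> carrier V \<Longrightarrow> x \<in> carrier U \<Longrightarrow> t_op (tens v x) = tens (t v) x"
  by (simp add: tensor_left_cls)

end

section \<open>The factorpower and its \<open>\<L>\<close>-class\<close>

locale maximal_orbit_action = group_action G M \<phi>
  for G :: "('g, 'z) monoid_scheme" (structure) and M :: "'m set" and \<phi> :: "'g \<Rightarrow> 'm \<Rightarrow> 'm" +
  fixes H :: "'g set"
  assumes maximal: "orbit_maximal G M \<phi> H" and finite_G: "finite (carrier G)"
begin

sublocale group G
  using group_hom by (rule group_hom.axioms)

sublocale H: subgroup H G
  using maximal by (simp add: orbit_maximal_def)

abbreviation "cl A \<equiv> fp_class G M \<phi> A"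
abbreviation "FP \<equiv> factorpower G M \<phi>"
abbreviation "LH \<equiv> L_H G M \<phi> H"
abbreviation "ne A \<equiv> A \<noteq> {} \<and> A \<subseteq> carrier G"

lemma action_closed: "g \<in> carrier G \<Longrightarrow> m \<in> M \<Longrightarrow> \<phi> g m \<in> M"
  using element_image by blast

lemma action_inv: "g \<in> carrier G \<Longrightarrow> m \<in> M \<Longrightarrow> \<phi> (inv g) (\<phi> g m) = m"
  using orbit_sym_aux by blast

lemma fp_rel_iff:
  "(A, B) \<in> fp_rel G M \<phi> \<longleftrightarrow>
     ne A \<and> ne B \<and> (\<forall>m\<in>M. (\<lambda>a. \<phi> a m) ` A = (\<lambda>a. \<phi> a m) ` B)"
proof -
  have "{\<phi> a m |a. a \<in> A} = (\<lambda>a. \<phi> a m) ` A" for A m by blast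
  then show ?thesis unfolding fp_rel_def by blast
qed

lemma equiv_fp_rel: "equiv {A. ne A} (fp_rel G M \<phi>)"
proof (rule equivI)
  show "fp_rel G M \<phi> \<subseteq> {A. ne A} \<times> {A. ne A}" by (auto simp: fp_rel_iff)
  show "refl_on {A. ne A} (fp_rel G M \<phi>)" by (auto simp: refl_on_def fp_rel_iff)
  show "sym (fp_rel G M \<phi>)" by (auto simp: sym_def fp_rel_iff)
  show "trans (fp_rel G M \<phi>)" unfolding trans_def fp_rel_iff by simp
qed

lemma cl_eq_iff:
  assumes "ne A" "ne B"
  shows "cl A = cl B \<longleftrightarrow> (\<forall>m\<in>M. (\<lambda>a. \<phi> a m) ` A = (\<lambda>a. \<phi> a m) ` B)"
  using eq_equiv_class_iff[OF equiv_fp_rel, of A B] assms by (simp add: fp_class_def fp_rel_iff)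

text \<open>The conjunct \<open>ne A\<close> cannot be dropped: inadmissible sets all have the empty
  class, so equality of classes alone would not give membership.\<close>

lemma mem_cl: "B \<in> cl A \<longleftrightarrow> ne A \<and> ne B \<and> cl A = cl B"
proof -
  have "B \<in> cl A \<longleftrightarrow> (A, B) \<in> fp_rel G M \<phi>" by (simp add: fp_class_def)
  then show ?thesis using cl_eq_iff[of A B] unfolding fp_rel_iff by blast
qed

lemma carrier_FP: "carrier FP = cl ` {A. ne A}"
  by (auto simp: factorpower_def quotient_def fp_class_def)

lemma one_FP: "\<one>\<^bsub>FP\<^esub> = cl {\<one>}"
  by (simp add: factorpower_def)

lemma mem_l_coset: "x \<in> a <# B \<longleftrightarrow> (\<exists>b\<in>B. x = a \<otimes> b)"
  by (auto simp: l_coset_def)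

lemma mem_r_coset: "x \<in> B #> a \<longleftrightarrow> (\<exists>b\<in>B. x = b \<otimes> a)"
  by (auto simp: r_coset_def)

lemma ne_mult: "ne A \<Longrightarrow> ne B \<Longrightarrow> ne (A <#> B)"
  using set_mult_closed[of A B] by (auto simp: set_mult_def)

lemma ne_H: "ne H"
  using H.subset H.one_closed by blast

lemma ne_l_coset: "g \<in> carrier G \<Longrightarrow> ne A \<Longrightarrow> ne (g <# A)"
  by (auto simp: l_coset_def)

lemma ne_r_coset: "g \<in> carrier G \<Longrightarrow> ne A \<Longrightarrow> ne (A #> g)"
  by (auto simp: r_coset_def)

lemma ne_inv: "ne A \<Longrightarrow> ne (set_inv A)"
  by (auto simp: SET_INV_def)

text \<open>The image of m under AB is obtained from that of m under B and those of its points under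
  A. So the class of AB depends only on the classes of A and B, which is the congruence property
  behind \<open>mult_cl\<close>.\<close>

lemma image_set_mult:
  assumes "ne A" "ne B" "m \<in> M"
  shows "(\<lambda>c. \<phi> c m) ` (A <#> B) = (\<Union>n\<in>(\<lambda>b. \<phi> b m) ` B. (\<lambda>a. \<phi> a n) ` A)"
proof -
  have "\<phi> (a \<otimes> b) m = \<phi> a (\<phi> b m)" if "a \<in> A" "b \<in> B" for a b
    using assms that by (intro composition_rule) auto
  then show ?thesis by (auto simp: set_mult_def image_iff) blast+
qed

lemma mult_cl:
  assumes "ne A" "ne B"
  shows "cl A \<otimes>\<^bsub>FP\<^esub> cl B = cl (A <#> B)"
proof -
  have "cl (A' <#> B') = cl (A <#> B)" if "A' \<in> cl A" "B' \<in> cl B" for A' B'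
  proof -
    have ne: "ne A'" "ne B'" using that by (auto simp: mem_cl)
    have "(\<lambda>a. \<phi> a m) ` A = (\<lambda>a. \<phi> a m) ` A'" "(\<lambda>a. \<phi> a m) ` B = (\<lambda>a. \<phi> a m) ` B'"
      if "m \<in> M" for m
      using that \<open>A' \<in> cl A\<close> \<open>B' \<in> cl B\<close> assms cl_eq_iff[of A A'] cl_eq_iff[of B B'] ne
      by (simp_all add: mem_cl)
    note eq = this
    have "(\<lambda>c. \<phi> c m) ` (A' <#> B') = (\<lambda>c. \<phi> c m) ` (A <#> B)" if m: "m \<in> M" for m
    proof -
      have "(\<lambda>a. \<phi> a n) ` A = (\<lambda>a. \<phi> a n) ` A'" if "n \<in> (\<lambda>b. \<phi> b m) ` B" for n
        using that m assms action_closed by (intro eq(1)) auto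
      then show ?thesis
        unfolding image_set_mult[OF ne m] image_set_mult[OF assms m] eq(2)[OF m, symmetric]
        by (intro SUP_cong) auto
    qed
    then show ?thesis using ne assms ne_mult by (subst cl_eq_iff) auto
  qed
  then have "(\<Union>A'\<in>cl A. \<Union>B'\<in>cl B. cl (A' <#> B')) = (\<Union>A'\<in>cl A. \<Union>B'\<in>cl B. cl (A <#> B))"
    by (intro SUP_cong refl)
  moreover have "A \<in> cl A" "B \<in> cl B" using assms by (auto simp: mem_cl)
  ultimately show ?thesis unfolding factorpower_def by auto
qed

text \<open>A point n lies in the image of m under B^-1 iff m lies in the image of n under B.
  Inversion thus transposes the relation on \<open>M\<close> given by B, and that relation is all
  the class records.\<close>

lemma star_cl:
  assumes "ne A"
  shows "fp_star G M \<phi> (cl A) = cl (set_inv A)"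
proof -
  have sub: "(\<lambda>a. \<phi> a m) ` (set_inv B) \<subseteq> (\<lambda>a. \<phi> a m) ` (set_inv B')"
    if "ne B" "ne B'" "cl B = cl B'" "m \<in> M" for B B' m
  proof
    fix n assume "n \<in> (\<lambda>a. \<phi> a m) ` (set_inv B)"
    then obtain b where b: "b \<in> B" "n = \<phi> (inv b) m" by (auto simp: SET_INV_def)
    then have bG: "b \<in> carrier G" using that by auto
    then have "n \<in> M" using b that action_closed by auto
    moreover have "\<phi> b n = m" using b bG action_inv[of "inv b" m] that by simp
    moreover have "(\<lambda>a. \<phi> a n) ` B = (\<lambda>a. \<phi> a n) ` B'"
      using that \<open>n \<in> M\<close> cl_eq_iff[OF that(1,2)] by blast
    ultimately have "m \<in> (\<lambda>a. \<phi> a n) ` B'" using b(1) by blast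
    then obtain b' where b': "b' \<in> B'" "\<phi> b' n = m" by blast
    then have "n = \<phi> (inv b') m" using action_inv[of b' n] that \<open>n \<in> M\<close> by auto
    then show "n \<in> (\<lambda>a. \<phi> a m) ` (set_inv B')" using b' by (auto simp: SET_INV_def)
  qed
  have "cl (set_inv B) = cl (set_inv A)" if "B \<in> cl A" for B
  proof -
    have AB: "ne A" "ne B" "cl A = cl B" using that by (auto simp: mem_cl)
    then show ?thesis
      unfolding cl_eq_iff[OF ne_inv[OF AB(2)] ne_inv[OF AB(1)]]
      using sub[OF AB] sub[OF AB(2,1) AB(3)[symmetric]] by blast
  qed
  then have "fp_star G M \<phi> (cl A) = (\<Union>B\<in>cl A. cl (set_inv A))"
    unfolding fp_star_def by (intro SUP_cong refl)
  moreover have "A \<in> cl A" using assms by (simp add: mem_cl)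
  ultimately show ?thesis by auto
qed

text \<open>The set of all elements preserving the \<open>H\<close>-orbits is a subgroup that is orbit-equivalent
  to \<open>H\<close>.\<close>

lemma mem_H:
  assumes "g \<in> carrier G" "\<And>m. m \<in> M \<Longrightarrow> \<exists>h\<in>H. \<phi> g m = \<phi> h m"
  shows "g \<in> H"
proof -
  define K where "K = {g \<in> carrier G. \<forall>m\<in>M. \<exists>h\<in>H. \<phi> g m = \<phi> h m}"
  have HG: "h \<in> carrier G" if "h \<in> H" for h using that by (rule H.mem_carrier)
  have "subgroup K G"
  proof (rule subgroupI)
    show "K \<subseteq> carrier G" by (auto simp: K_def)
    have "\<one> \<in> K" using H.one_closed unfolding K_def by blast
    then show "K \<noteq> {}" by blast
  next
    fix a assume a: "a \<in> K"
    have "\<exists>h\<in>H. \<phi> (inv a) m = \<phi> h m" if m: "m \<in> M" for m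
    proof -
      have aG: "a \<in> carrier G" using a by (simp add: K_def)
      have n: "\<phi> (inv a) m \<in> M" using aG m by (simp add: action_closed)
      have "\<phi> a (\<phi> (inv a) m) = m" using action_inv[of "inv a" m] aG m by simp
      moreover obtain h where h: "h \<in> H" "\<phi> a (\<phi> (inv a) m) = \<phi> h (\<phi> (inv a) m)"
        using a n by (auto simp: K_def)
      \<comment> \<open>Both \<open>a\<close> and \<open>h\<close> send the point
        \<open>\<phi> (inv a) m\<close> to \<open>m\<close>; apply \<open>inv h\<close>.\<close>
      ultimately have "\<phi> (inv a) m = \<phi> (inv h) m" using action_inv[of h "\<phi> (inv a) m"] n HG by simp
      then show ?thesis using h by blast
    qed
    then show "inv a \<in> K" using a by (simp add: K_def)
  next
    fix a b assume ab: "a \<in> K" "b \<in> K"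
    have "\<exists>h\<in>H. \<phi> (a \<otimes> b) m = \<phi> h m" if m: "m \<in> M" for m
    proof -
      obtain h where h: "h \<in> H" "\<phi> b m = \<phi> h m" using ab m by (auto simp: K_def)
      then have "\<phi> h m \<in> M" using m HG by (simp add: action_closed)
      then obtain k where k: "k \<in> H" "\<phi> a (\<phi> h m) = \<phi> k (\<phi> h m)" using ab by (auto simp: K_def)
      have "\<phi> (a \<otimes> b) m = \<phi> (k \<otimes> h) m"
        using ab h k m HG by (simp add: K_def composition_rule)
      then show ?thesis using h k by blast
    qed
    then show "a \<otimes> b \<in> K" using ab by (simp add: K_def)
  qed
  moreover have "H \<subseteq> K" using HG by (auto simp: K_def)
  moreover have "orbit (G\<lparr>carrier := H\<rparr>) \<phi> m = orbit (G\<lparr>carrier := K\<rparr>) \<phi> m" if "m \<in> M" for m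
    using that \<open>H \<subseteq> K\<close> unfolding orbit_def K_def by fastforce
  then have "orbit_equivalent G M \<phi> H K"
    unfolding orbit_equivalent_def orbits_def by blast
  ultimately have "K = H" using maximal by (auto simp: orbit_maximal_def)
  then show ?thesis using assms by (auto simp: K_def)
qed

lemma finite_H: "finite H"
  using finite_G H.subset by (rule rev_finite_subset)

section \<open>Left cosets as the elements of the \<L>-class\<close>

abbreviation "coset g \<equiv> g <# H"

lemma mem_coset: "x \<in> carrier G \<Longrightarrow> g \<in> carrier G \<Longrightarrow> x \<in> coset g \<longleftrightarrow> inv g \<otimes> x \<in> H"
proof
  assume x: "x \<in> carrier G" "g \<in> carrier G" "x \<in> coset g"
  then obtain h where "h \<in> H" "x = g \<otimes> h" by (auto simp: mem_l_coset)
  then show "inv g \<otimes> x \<in> H" using x H.mem_carrier by (simp add: inv_solve_left' m_assoc[symmetric])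
next
  assume x: "x \<in> carrier G" "g \<in> carrier G" "inv g \<otimes> x \<in> H"
  then have "x = g \<otimes> (inv g \<otimes> x)" by (simp add: m_assoc[symmetric])
  then show "x \<in> coset g" using x by (auto simp: mem_l_coset)
qed

lemma coset_carrier: "g \<in> carrier G \<Longrightarrow> coset g \<subseteq> carrier G"
  using H.subset by (auto simp: l_coset_def)

lemma coset_eq: "x \<in> coset g \<Longrightarrow> g \<in> carrier G \<Longrightarrow> coset x = coset g"
  using l_repr_independence H.subgroup_axioms by blast

lemma coset_self: "g \<in> carrier G \<Longrightarrow> g \<in> coset g"
  using H.one_closed by (force simp: mem_l_coset)

lemma coset_mult_H: "g \<in> carrier G \<Longrightarrow> coset g <#> H = coset g"
  by (simp add: H.subset l_coset_eq_set_mult set_mult_assoc subgroup_mult_id[OF H.subgroup_axioms])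

lemma ne_coset: "g \<in> carrier G \<Longrightarrow> ne (coset g)"
  by (simp add: ne_l_coset ne_H)

text \<open>With any element a, the set contains all of aH, and aH is already the whole of
  gH.\<close>

lemma coset_subset:
  assumes "A \<noteq> {}" "g \<in> carrier G" "A \<subseteq> coset g" "A <#> H \<subseteq> A"
  shows "A = coset g"
proof
  obtain a where a: "a \<in> A" using assms(1) by blast
  then have "coset a = coset g" using assms coset_eq by blast
  moreover have "coset a \<subseteq> A <#> H" using a unfolding l_coset_def set_mult_def by blast
  ultimately show "coset g \<subseteq> A" using assms(4) by blast
qed fact

text \<open>This is where orbit-maximality acts: for a in A, the element g^-1 a moves every point
  within its \<open>H\<close>-orbit, hence belongs to \<open>H\<close>. In other words, gH is the
  largest representative of its class.\<close>

lemma cl_eq_coset_subset: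
  assumes "ne A" "g \<in> carrier G" "cl A = cl (coset g)"
  shows "A \<subseteq> coset g"
proof
  fix a assume a: "a \<in> A"
  have aG: "a \<in> carrier G" using a assms by blast
  have "\<exists>h\<in>H. \<phi> (inv g \<otimes> a) m = \<phi> h m" if m: "m \<in> M" for m
  proof -
    have "\<phi> a m \<in> (\<lambda>a. \<phi> a m) ` coset g"
      using a m assms cl_eq_iff[OF assms(1) ne_coset] by blast
    then obtain h where h: "h \<in> H" "\<phi> a m = \<phi> (g \<otimes> h) m" by (auto simp: mem_l_coset)
    have hG: "h \<in> carrier G" using h(1) by (rule H.mem_carrier)
    have "\<phi> (inv g \<otimes> a) m = \<phi> (inv g) (\<phi> (g \<otimes> h) m)"
      using h m aG assms(2) by (simp add: composition_rule)
    also have "\<dots> = \<phi> h m" using m hG assms(2) by (simp add: composition_rule action_closed action_inv)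
    finally show ?thesis using h by blast
  qed
  then show "a \<in> coset g" using mem_H[of "inv g \<otimes> a"] mem_coset aG assms(2) by simp
qed

lemma singleton_mult: "{g} <#> A = g <# A"
  by (simp add: l_coset_eq_set_mult)

text \<open>If A and H generate the same left ideal, then A ~ SH and H ~ BSH for some S and B.
  Maximality gives BSH \<subseteq> H, so that for any b in B the set SH lies in b^-1 H and fills it.
  Conversely, A (gH) = (Ag) H, so translating the left factor by g or g^-1 turns elements of either
  ideal into elements of the other.\<close>

lemma L_H_iff: "x \<in> LH \<longleftrightarrow> (\<exists>g\<in>carrier G. x = cl (coset g))"
proof
  assume "x \<in> LH"
  then obtain A where A: "ne A" "x = cl A"
    and ideal: "(\<lambda>s. s \<otimes>\<^bsub>FP\<^esub> cl A) ` carrier FP = (\<lambda>s. s \<otimes>\<^bsub>FP\<^esub> cl H) ` carrier FP"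
    by (auto simp: L_H_def Green_L_class_def carrier_FP)
  have one: "ne {\<one>}" by simp
  have id: "cl {\<one>} \<otimes>\<^bsub>FP\<^esub> cl B = cl B" if "ne B" for B
    using mult_cl[OF one that] that by (simp add: singleton_mult lcos_mult_one)
  have one_in: "cl {\<one>} \<in> carrier FP" using one unfolding carrier_FP by (intro imageI) simp
  have "cl A \<in> (\<lambda>s. s \<otimes>\<^bsub>FP\<^esub> cl H) ` carrier FP"
    unfolding ideal[symmetric] by (rule image_eqI[where x = "cl {\<one>}"]) (simp_all only: id[OF A(1)] one_in)
  then obtain S where S: "ne S" "cl A = cl S \<otimes>\<^bsub>FP\<^esub> cl H" unfolding carrier_FP by blast
  have SH: "ne (S <#> H)" by (rule ne_mult[OF S(1) ne_H])
  have A_eq: "cl A = cl (S <#> H)" using S(2) mult_cl[OF S(1) ne_H] by simp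
  have "cl H \<in> (\<lambda>s. s \<otimes>\<^bsub>FP\<^esub> cl A) ` carrier FP"
    unfolding ideal by (rule image_eqI[where x = "cl {\<one>}"]) (simp_all only: id[OF ne_H] one_in)
  then obtain B where B: "ne B" "cl H = cl B \<otimes>\<^bsub>FP\<^esub> cl (S <#> H)"
    unfolding carrier_FP A_eq by blast
  \<comment> \<open>Viewing \<open>H\<close> as the coset of \<one> makes
    \<open>cl_eq_coset_subset\<close> applicable.\<close>
  have "cl (B <#> (S <#> H)) = cl (coset \<one>)"
    using B(2) mult_cl[OF B(1) SH] by (simp add: lcos_mult_one H.subset)
  then have sub: "B <#> (S <#> H) \<subseteq> coset \<one>"
    by (intro cl_eq_coset_subset ne_mult B(1) SH one_closed)
  obtain b where b: "b \<in> B" "b \<in> carrier G" using B by blast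
  have "S <#> H \<subseteq> coset (inv b)"
  proof
    fix y assume y: "y \<in> S <#> H"
    then have "b \<otimes> y \<in> coset \<one>" using sub b unfolding set_mult_def by blast
    moreover have "y \<in> carrier G" using y SH by blast
    ultimately show "y \<in> coset (inv b)"
      using b by (simp add: mem_coset)
  qed
  then have "S <#> H = coset (inv b)"
    using SH b S(1)
    by (intro coset_subset) (simp_all add: set_mult_assoc H.subset subgroup_mult_id[OF H.subgroup_axioms])
  then have "x = cl (coset (inv b))" using A(2) A_eq by simp
  then show "\<exists>g\<in>carrier G. x = cl (coset g)" using b(2) by blast
next
  assume "\<exists>g\<in>carrier G. x = cl (coset g)"
  then obtain g where g: "g \<in> carrier G" "x = cl (coset g)" by blast
  have mult: "cl A \<otimes>\<^bsub>FP\<^esub> cl (coset a) = cl (A #> a) \<otimes>\<^bsub>FP\<^esub> cl H"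
    if "ne A" "a \<in> carrier G" for A a
    using that by (simp add: mult_cl ne_coset ne_r_coset ne_H rcos_assoc_lcos H.subset)
  have "(\<lambda>s. s \<otimes>\<^bsub>FP\<^esub> x) ` carrier FP = (\<lambda>s. s \<otimes>\<^bsub>FP\<^esub> cl H) ` carrier FP"
  proof (intro equalityI subsetI)
    fix y assume "y \<in> (\<lambda>s. s \<otimes>\<^bsub>FP\<^esub> x) ` carrier FP"
    then obtain A where A: "ne A" "y = cl A \<otimes>\<^bsub>FP\<^esub> x" unfolding carrier_FP by blast
    then have "y = cl (A #> g) \<otimes>\<^bsub>FP\<^esub> cl H" using g mult by simp
    then show "y \<in> (\<lambda>s. s \<otimes>\<^bsub>FP\<^esub> cl H) ` carrier FP"
      unfolding carrier_FP using ne_r_coset[OF g(1) A(1)] by blast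
  next
    fix y assume "y \<in> (\<lambda>s. s \<otimes>\<^bsub>FP\<^esub> cl H) ` carrier FP"
    then obtain A where A: "ne A" "y = cl A \<otimes>\<^bsub>FP\<^esub> cl H" unfolding carrier_FP by blast
    have "A #> inv g #> g = A" using A g by (simp add: coset_mult_assoc)
    moreover have ne: "ne (A #> inv g)" by (rule ne_r_coset[OF inv_closed[OF g(1)] A(1)])
    ultimately have "y = cl (A #> inv g) \<otimes>\<^bsub>FP\<^esub> x"
      using mult[OF ne g(1)] A(2) g(2) by simp
    then show "y \<in> (\<lambda>s. s \<otimes>\<^bsub>FP\<^esub> x) ` carrier FP"
      unfolding carrier_FP using ne by blast
  qed
  moreover have "x \<in> carrier FP" unfolding carrier_FP g(2) using ne_coset[OF g(1)] by blast
  ultimately show "x \<in> LH" by (simp add: L_H_def Green_L_class_def)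
qed

text \<open>S g H is stable under right multiplication by \<open>H\<close>, so it cannot be a proper
  part of a left coset.\<close>

lemma mult_coset_subset:
  assumes "ne S" "g \<in> carrier G" "g' \<in> carrier G" "S <#> coset g \<subseteq> coset g'"
  shows "S <#> coset g = coset g'"
  using assms ne_mult[OF assms(1) ne_coset[OF assms(2)]] coset_carrier[of g]
  by (intro coset_subset) (auto simp: set_mult_assoc H.subset coset_mult_H)

text \<open>Translates the condition deciding whether the truncated action vanishes into an
  inclusion of subsets, free of classes.\<close>

lemma cl_mult_coset_in_LH:
  assumes "ne S" "g \<in> carrier G"
  shows "cl (S <#> coset g) \<in> LH \<longleftrightarrow> (\<exists>g'\<in>carrier G. S <#> coset g \<subseteq> coset g')"
proof
  assume "cl (S <#> coset g) \<in> LH"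
  then obtain g' where g': "g' \<in> carrier G" "cl (S <#> coset g) = cl (coset g')"
    unfolding L_H_iff by blast
  then show "\<exists>g'\<in>carrier G. S <#> coset g \<subseteq> coset g'"
    using cl_eq_coset_subset[OF ne_mult[OF assms(1) ne_coset[OF assms(2)]] g'] by blast
next
  assume "\<exists>g'\<in>carrier G. S <#> coset g \<subseteq> coset g'"
  then obtain g' where g': "g' \<in> carrier G" "S <#> coset g \<subseteq> coset g'" by blast
  then show "cl (S <#> coset g) \<in> LH"
    unfolding L_H_iff mult_coset_subset[OF assms g'] by blast
qed

lemma normalizer_iff:
  "n \<in> normalizer G H \<longleftrightarrow> n \<in> carrier G \<and> n <# H #> inv n = H"
  using H.subset by (auto simp: normalizer_def stabilizer_def)

lemma normalizer_coset:
  assumes "n \<in> normalizer G H"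
  shows "H #> n = n <# H"
proof -
  have n: "n \<in> carrier G" "n <# H #> inv n = H" using assms by (auto simp: normalizer_iff)
  have "H #> n = n <# H #> inv n #> n" by (simp add: n)
  also have "\<dots> = n <# H" using n(1) coset_carrier[of n] by (simp add: coset_mult_assoc)
  finally show ?thesis .
qed

text \<open>The factor group is made of right cosets, the \<L>-class of left ones; for elements of
  the normalizer the two agree.\<close>

lemma carrier_normalizer_quotient:
  "carrier (normalizer_quotient G H) = coset ` normalizer G H"
  using normalizer_coset
  by (auto simp: normalizer_quotient_def carrier_FactGroup image_iff)

lemma normalizer_subgroup: "subgroup (normalizer G H) G"
  by (rule normalizer_imp_subgroup[OF H.subset])

end

section \<open>The module \<open>L(H, U)\<close> in terms of cosets\<close>

locale factorpower_module = maximal_orbit_action G M \<phi> H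
  for G :: "('g, 'z) monoid_scheme" (structure) and M :: "'m set" and \<phi> and H +
  fixes U :: "(complex, 'x) module" and \<rho> :: "'g set \<Rightarrow> 'x \<Rightarrow> 'x"
  assumes rep: "linear_representation (normalizer_quotient G H) U \<rho>"
begin

abbreviation "VH \<equiv> V_H G M \<phi> H"
abbreviation "NQ \<equiv> normalizer_quotient G H"
abbreviation "act_left S \<equiv> V_H_left G M \<phi> H (cl S)"
abbreviation "act_right \<equiv> V_H_right G M \<phi> H"

lemma V_H_action_closed: "v \<in> carrier VH \<Longrightarrow> V_H_action G M \<phi> H s C v \<in> carrier VH"
  unfolding V_H_action_def V_H_def by (rule lin_ext_closed) (auto simp: Let_def)

lemma V_H_action_add:
  "v \<in> carrier VH \<Longrightarrow> w \<in> carrier VH \<Longrightarrow>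
    V_H_action G M \<phi> H s C (v \<oplus>\<^bsub>VH\<^esub> w) = V_H_action G M \<phi> H s C v \<oplus>\<^bsub>VH\<^esub> V_H_action G M \<phi> H s C w"
  unfolding V_H_action_def V_H_def formal_span_simps by (rule lin_ext_add)

lemma V_H_action_smult:
  "v \<in> carrier VH \<Longrightarrow>
    V_H_action G M \<phi> H s C (c \<odot>\<^bsub>VH\<^esub> v) = c \<odot>\<^bsub>VH\<^esub> V_H_action G M \<phi> H s C v"
  unfolding V_H_action_def V_H_def formal_span_simps by (rule lin_ext_smult)

text \<open>The left action carries a trailing factor \<open>cl H\<close>, the identity of N(H)/H on
  the right; gH absorbs it.\<close>

lemma act_left_single:
  assumes "ne S" "g \<in> carrier G"
  shows "act_left S (single_vec (cl (coset g))) =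
    (if \<exists>g'\<in>carrier G. S <#> coset g \<subseteq> coset g' then single_vec (cl (S <#> coset g)) else (\<lambda>_. 0))"
proof -
  have SG: "S \<subseteq> carrier G" using assms(1) by blast
  have "cl S \<otimes>\<^bsub>FP\<^esub> cl (coset g) \<otimes>\<^bsub>FP\<^esub> cl H = cl (S <#> coset g <#> H)"
    by (simp only: mult_cl[OF assms(1) ne_coset[OF assms(2)]]
        mult_cl[OF ne_mult[OF assms(1) ne_coset[OF assms(2)]] ne_H])
  also have "S <#> coset g <#> H = S <#> coset g"
    by (simp only: set_mult_assoc[OF SG coset_carrier[OF assms(2)] H.subset] coset_mult_H[OF assms(2)])
  finally show ?thesis
    by (simp only: V_H_action_def lin_ext_single Let_def cl_mult_coset_in_LH[OF assms])
qed

lemma coset_mult_normalizer: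
  assumes "n \<in> normalizer G H" "g \<in> carrier G"
  shows "coset g #> n = coset (g \<otimes> n)"
proof -
  have n: "n \<in> carrier G" using assms(1) by (simp add: normalizer_iff)
  have "coset g #> n = g <# (H #> n)" using n assms(2) H.subset by (simp add: coset_assoc)
  also have "\<dots> = g <# (n <# H)" by (simp only: normalizer_coset[OF assms(1)])
  also have "\<dots> = coset (g \<otimes> n)" using n assms(2) H.subset by (simp add: lcos_m_assoc)
  finally show ?thesis .
qed

lemma coset_mult_coset_normalizer:
  assumes "n \<in> normalizer G H" "g \<in> carrier G"
  shows "coset g <#> coset n = coset (g \<otimes> n)"
proof -
  have n: "n \<in> carrier G" using assms(1) by (simp add: normalizer_iff)
  have "coset g <#> coset n = coset g <#> (H <#> {n})"
    by (simp only: normalizer_coset[OF assms(1), symmetric] r_coset_eq_set_mult)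
  also have "\<dots> = coset g <#> H <#> {n}"
    by (rule set_mult_assoc[symmetric]) (use n coset_carrier[OF assms(2)] H.subset in auto)
  also have "\<dots> = coset g #> n" by (simp only: coset_mult_H[OF assms(2)] r_coset_eq_set_mult)
  finally show ?thesis by (simp only: coset_mult_normalizer[OF assms])
qed

text \<open>Right multiplication by the normalizer takes left cosets of \<open>H\<close> to left
  cosets, so the zero branch of the action does not occur.\<close>

lemma act_right_single:
  assumes "n \<in> normalizer G H" "g \<in> carrier G"
  shows "act_right (coset n) (single_vec (cl (coset g))) = single_vec (cl (coset (g \<otimes> n)))"
proof -
  have n: "n \<in> carrier G" using assms(1) by (simp add: normalizer_iff)
  have one: "ne {\<one>}" by simp
  have "\<one>\<^bsub>FP\<^esub> \<otimes>\<^bsub>FP\<^esub> cl (coset g) \<otimes>\<^bsub>FP\<^esub> cl (coset n) = cl ({\<one>} <#> coset g <#> coset n)"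
    by (simp only: one_FP mult_cl[OF one ne_coset[OF assms(2)]]
        mult_cl[OF ne_mult[OF one ne_coset[OF assms(2)]] ne_coset[OF n]])
  also have "{\<one>} <#> coset g <#> coset n = coset (g \<otimes> n)"
    by (simp only: singleton_mult lcos_mult_one[OF coset_carrier[OF assms(2)]]
        coset_mult_coset_normalizer[OF assms])
  finally have eq: "\<one>\<^bsub>FP\<^esub> \<otimes>\<^bsub>FP\<^esub> cl (coset g) \<otimes>\<^bsub>FP\<^esub> cl (coset n) = cl (coset (g \<otimes> n))" .
  have "cl (coset (g \<otimes> n)) \<in> LH" using n assms(2) unfolding L_H_iff by blast
  then show ?thesis by (simp add: V_H_action_def Let_def eq)
qed

text \<open>The point is that both sides vanish together. An inclusion S g H \<subseteq> g' H
  translates by n to S gn H \<subseteq> g'n H, and translating by n^-1 leads back.\<close>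

lemma act_commute_single:
  assumes "ne S" "n \<in> normalizer G H" "g \<in> carrier G"
  shows "act_left S (act_right (coset n) (single_vec (cl (coset g)))) =
    act_right (coset n) (act_left S (single_vec (cl (coset g))))"
proof -
  have SG: "S \<subseteq> carrier G" using assms(1) by blast
  have n: "n \<in> carrier G" using assms(2) by (simp add: normalizer_iff)
  have inv_n: "inv n \<in> normalizer G H" using normalizer_subgroup assms(2) by (rule subgroup.m_inv_closed)
  have move: "S <#> coset (a \<otimes> p) \<subseteq> coset (g' \<otimes> p)"
    if "p \<in> normalizer G H" "a \<in> carrier G" "g' \<in> carrier G" "S <#> coset a \<subseteq> coset g'" for a p g'
  proof -
    have p: "p \<in> carrier G" using that(1) by (simp add: normalizer_iff)
    have "S <#> coset (a \<otimes> p) = S <#> coset a #> p"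
      using that p SG coset_carrier
      by (simp add: coset_mult_normalizer[symmetric] setmult_rcos_assoc)
    also have "\<dots> \<subseteq> coset g' #> p" using that(4) unfolding r_coset_def by blast
    finally show ?thesis using that by (simp add: coset_mult_normalizer)
  qed
  have gn: "g \<otimes> n \<in> carrier G" using assms n by simp
  show ?thesis
  proof (cases "\<exists>g'\<in>carrier G. S <#> coset g \<subseteq> coset g'")
    case True
    then obtain g' where g': "g' \<in> carrier G" "S <#> coset g \<subseteq> coset g'" by blast
    have g'n: "g' \<otimes> n \<in> carrier G" using g' n by simp
    note sub = move[OF assms(2,3) g']
    have "S <#> coset g = coset g'" by (rule mult_coset_subset[OF assms(1,3) g'])
    then have "act_right (coset n) (act_left S (single_vec (cl (coset g)))) =
        single_vec (cl (coset (g' \<otimes> n)))"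
      using True by (simp add: act_left_single[OF assms(1,3)] act_right_single[OF assms(2) g'(1)])
    moreover have "S <#> coset (g \<otimes> n) = coset (g' \<otimes> n)"
      by (rule mult_coset_subset[OF assms(1) gn g'n sub])
    then have "act_left S (act_right (coset n) (single_vec (cl (coset g)))) =
        single_vec (cl (coset (g' \<otimes> n)))"
      unfolding act_right_single[OF assms(2,3)] act_left_single[OF assms(1) gn] using g'n by auto
    ultimately show ?thesis by simp
  next
    case False
    have "\<not> (\<exists>g'\<in>carrier G. S <#> coset (g \<otimes> n) \<subseteq> coset g')"
    proof
      assume "\<exists>g'\<in>carrier G. S <#> coset (g \<otimes> n) \<subseteq> coset g'"
      then obtain g' where g': "g' \<in> carrier G" "S <#> coset (g \<otimes> n) \<subseteq> coset g'" by blast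
      have "S <#> coset g \<subseteq> coset (g' \<otimes> inv n)"
        using move[OF inv_n gn g'] assms(3) n by (simp add: m_assoc)
      then show False using False g' n by (meson inv_closed m_closed)
    qed
    then show ?thesis using False
      by (simp add: act_right_single[OF assms(2,3)] act_left_single[OF assms(1,3)]
          act_left_single[OF assms(1) gn]) (simp add: V_H_action_def)
  qed
qed

lemma act_commute:
  assumes "ne S" "C \<in> carrier NQ" "v \<in> carrier VH"
  shows "act_left S (act_right C v) = act_right C (act_left S v)"
proof -
  obtain n where n: "n \<in> normalizer G H" "C = coset n"
    using assms(2) by (auto simp: carrier_normalizer_quotient)
  have "v \<in> carrier (formal_span LH)" using assms(3) by (simp add: V_H_def)
  then show ?thesis
  proof (induction rule: formal_span_induct)
    case zero
    show ?case by (simp add: V_H_action_def)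
  next
    case (step b c f)
    obtain g where g: "g \<in> carrier G" "b = cl (coset g)" using step.hyps(1) by (auto simp: L_H_iff)
    have b: "single_vec b \<in> carrier VH" "f \<in> carrier VH" using step.hyps by (simp_all add: V_H_def)
    then have cb: "c \<odot>\<^bsub>VH\<^esub> single_vec b \<in> carrier VH"
      by (simp add: V_H_def formal_span_smult)
    have v: "(\<lambda>x. c * single_vec b x + f x) = c \<odot>\<^bsub>VH\<^esub> single_vec b \<oplus>\<^bsub>VH\<^esub> f"
      by (simp add: V_H_def)
    have c: "c \<odot>\<^bsub>VH\<^esub> w \<in> carrier VH" if "w \<in> carrier VH" for w
      using that by (simp add: V_H_def formal_span_smult)
    have "act_left S (act_right C (single_vec b)) = act_right C (act_left S (single_vec b))"
      unfolding n(2) g(2) by (rule act_commute_single[OF assms(1) n(1) g(1)])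
    then show ?case unfolding v
      using b cb step.IH by (simp add: V_H_action_add V_H_action_smult V_H_action_closed c)
  qed
qed

sublocale tp: tensor "carrier NQ" VH act_right U \<rho>
proof (rule tensor.intro)
  show "module complex_ring VH" unfolding V_H_def by (rule module_formal_span)
  show "module complex_ring U" using rep by (simp add: linear_representation_def)
  show "act_right q v \<in> carrier VH" if "q \<in> carrier NQ" "v \<in> carrier VH" for q v
    using that(2) by (rule V_H_action_closed)
  show "\<rho> q x \<in> carrier U" if "q \<in> carrier NQ" "x \<in> carrier U" for q x
    using that rep by (auto simp: linear_representation_def)
qed

abbreviation "L \<equiv> L_module G M \<phi> H U \<rho>"
abbreviation "Op S \<equiv> L_action G M \<phi> H U \<rho> (cl S)"

text \<open>The tensor gH \<otimes> x. These elements span \<open>L\<close> but are not independent: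
  moving a normalizer element across the tensor sign relates gn and x to g and n x.\<close>

definition gen :: "'g \<Rightarrow> 'x \<Rightarrow> ('g, 'x) L_elem" where
  "gen g x = tp.tens (single_vec (cl (coset g))) x"

lemma tensor_endo_act_left:
  "ne S \<Longrightarrow> tensor_endo (carrier NQ) VH act_right U \<rho> (act_left S)"
  by (intro tensor_endo.intro tp.tensor_axioms tensor_endo_axioms.intro V_H_action_closed
      V_H_action_add V_H_action_smult act_commute)

sublocale L: abelian_group L
  unfolding L_module_def by (rule tp.T.abelian_group_axioms)

lemma single_coset_closed: "g \<in> carrier G \<Longrightarrow> single_vec (cl (coset g)) \<in> carrier VH"
  unfolding V_H_def by (rule single_vec_closed) (auto simp: L_H_iff)

lemma gen_closed: "g \<in> carrier G \<Longrightarrow> x \<in> carrier U \<Longrightarrow> gen g x \<in> carrier L"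
  unfolding gen_def L_module_def by (intro tp.tens_closed single_coset_closed)

lemma L_induct [consumes 1, case_names zero step]:
  assumes "u \<in> carrier L" "P \<zero>\<^bsub>L\<^esub>"
    and step: "\<And>g x u. g \<in> carrier G \<Longrightarrow> x \<in> carrier U \<Longrightarrow> u \<in> carrier L \<Longrightarrow> P u \<Longrightarrow> P (gen g x \<oplus>\<^bsub>L\<^esub> u)"
  shows "P u"
  using assms(1) unfolding L_module_def
proof (induction rule: tp.tensor_induct)
  case zero
  then show ?case using assms(2) by (simp add: L_module_def)
next
  case (step v x u)
  have "v \<in> carrier (formal_span LH)" using step.hyps by (simp add: V_H_def)
  \<comment> \<open>The accumulated sum \<open>u\<close> stays in the claim, because
    \<open>v\<close> is itself a combination of coset vectors and each of its terms is prepended to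
    what is already there.\<close>
  then have "P (tp.tens v x \<oplus>\<^bsub>L\<^esub> u)"
  proof (induction rule: formal_span_induct)
    case zero
    have "tp.tens (\<lambda>_. 0) x = \<zero>\<^bsub>L\<^esub>"
      using tp.tens_zero_left[OF step.hyps(2)] by (simp add: L_module_def V_H_def)
    then show ?case using step.IH step.hyps by (simp add: L_module_def)
  next
    case (step b c f)
    note IH = step.IH
    obtain g where g: "g \<in> carrier G" "b = cl (coset g)" using step.hyps(1) by (auto simp: L_H_iff)
    have b: "single_vec b \<in> carrier VH" "f \<in> carrier VH" using step.hyps by (simp_all add: V_H_def)
    have cb: "c \<odot>\<^bsub>VH\<^esub> single_vec b \<in> carrier VH" using b(1) by (simp add: V_H_def formal_span_smult)
    have x: "x \<in> carrier U" "u \<in> carrier L" using \<open>x \<in> carrier U\<close> \<open>u \<in> carrier tp.T\<close>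
      by (simp_all add: L_module_def)
    have cx: "c \<odot>\<^bsub>U\<^esub> x \<in> carrier U" using x by simp
    have f: "tp.tens f x \<in> carrier L" using tp.tens_closed[OF b(2) x(1)] by (simp add: L_module_def)
    have "(\<lambda>y. c * single_vec b y + f y) = c \<odot>\<^bsub>VH\<^esub> single_vec b \<oplus>\<^bsub>VH\<^esub> f" by (simp add: V_H_def)
    then have "tp.tens (\<lambda>y. c * single_vec b y + f y) x = gen g (c \<odot>\<^bsub>U\<^esub> x) \<oplus>\<^bsub>L\<^esub> tp.tens f x"
      using tp.tens_add_left[OF cb b(2) x(1)] tp.tens_smult_left[OF b(1) x(1), of c]
        tp.tens_smult_right[OF b(1) x(1), of c]
      by (simp add: gen_def L_module_def g(2))
    then have "tp.tens (\<lambda>y. c * single_vec b y + f y) x \<oplus>\<^bsub>L\<^esub> u =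
        gen g (c \<odot>\<^bsub>U\<^esub> x) \<oplus>\<^bsub>L\<^esub> (tp.tens f x \<oplus>\<^bsub>L\<^esub> u)"
      using gen_closed[OF g(1) cx] f x by (simp add: L.a_assoc)
    then show ?case
      using assms(3)[OF g(1) cx L.a_closed[OF f x(2)] IH] by simp
  qed
  then show ?case by (simp add: L_module_def)
qed

context
  fixes S assumes S: "ne S"
begin

interpretation tensor_endo "carrier NQ" VH act_right U \<rho> "act_left S"
  by (rule tensor_endo_act_left[OF S])

lemma Op_closed: "u \<in> carrier L \<Longrightarrow> Op S u \<in> carrier L"
  unfolding L_module_def L_action_def by (rule tensor_left_closed)

lemma Op_add: "u \<in> carrier L \<Longrightarrow> w \<in> carrier L \<Longrightarrow> Op S (u \<oplus>\<^bsub>L\<^esub> w) = Op S u \<oplus>\<^bsub>L\<^esub> Op S w"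
  unfolding L_module_def L_action_def by (rule tensor_left_add)

lemma Op_smult: "u \<in> carrier L \<Longrightarrow> Op S (c \<odot>\<^bsub>L\<^esub> u) = c \<odot>\<^bsub>L\<^esub> Op S u"
  unfolding L_module_def L_action_def by (rule tensor_left_smult)

lemma Op_zero: "Op S \<zero>\<^bsub>L\<^esub> = \<zero>\<^bsub>L\<^esub>"
  using Op_add[of "\<zero>\<^bsub>L\<^esub>" "\<zero>\<^bsub>L\<^esub>"] Op_closed[of "\<zero>\<^bsub>L\<^esub>"]
  by (metis L.add.r_cancel_one' L.zero_closed L.r_zero)

text \<open>Together with \<open>Op_gen_zero\<close> this determines an operator on the spanning
  tensors by inclusions of subsets alone.\<close>

lemma Op_gen:
  assumes "g \<in> carrier G" "g' \<in> carrier G" "x \<in> carrier U" "S <#> coset g \<subseteq> coset g'"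
  shows "Op S (gen g x) = gen g' x"
proof -
  have "act_left S (single_vec (cl (coset g))) = single_vec (cl (coset g'))"
    using act_left_single[OF S assms(1)] mult_coset_subset[OF S assms(1,2,4)] assms(2,4) by auto
  then show ?thesis
    using tensor_left_tens[OF single_coset_closed[OF assms(1)] assms(3)]
    by (simp add: gen_def L_action_def)
qed

lemma Op_gen_zero:
  assumes "g \<in> carrier G" "x \<in> carrier U" "\<And>g'. g' \<in> carrier G \<Longrightarrow> \<not> S <#> coset g \<subseteq> coset g'"
  shows "Op S (gen g x) = \<zero>\<^bsub>L\<^esub>"
proof -
  have "act_left S (single_vec (cl (coset g))) = (\<lambda>_. 0)"
    using act_left_single[OF S assms(1)] assms(3) by auto
  then show ?thesis
    using tensor_left_tens[OF single_coset_closed[OF assms(1)] assms(2)] tp.tens_zero_left[OF assms(2)]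
    by (simp add: gen_def L_action_def L_module_def V_H_def)
qed

end

end

section \<open>Algebra of the operators\<close>

context factorpower_module
begin

text \<open>Truncation respects products: if B g H lies in no left coset, neither does A B g H,
  since for a in A the inclusion a B g H \<subseteq> g' H would put B g H into a^-1 g' H.\<close>

lemma Op_mult:
  assumes A: "ne A" and B: "ne B" and u: "u \<in> carrier L"
  shows "Op A (Op B u) = Op (A <#> B) u"
  using u
proof (induction rule: L_induct)
  case zero
  show ?case by (simp only: Op_zero[OF A] Op_zero[OF B] Op_zero[OF ne_mult[OF A B]])
next
  case (step g x u)
  have AB: "ne (A <#> B)" using A B by (rule ne_mult)
  have G: "A \<subseteq> carrier G" "B \<subseteq> carrier G" "coset g \<subseteq> carrier G"
    using A B coset_carrier[OF step.hyps(1)] by auto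
  have "Op A (Op B (gen g x)) = Op (A <#> B) (gen g x)"
  proof (cases "\<exists>g'\<in>carrier G. B <#> coset g \<subseteq> coset g'")
    case True
    then obtain g' where g': "g' \<in> carrier G" "B <#> coset g \<subseteq> coset g'" by blast
    have "B <#> coset g = coset g'" by (rule mult_coset_subset[OF B step.hyps(1) g'])
    then have ABg: "A <#> B <#> coset g = A <#> coset g'" using set_mult_assoc[OF G] by simp
    have Bg: "Op B (gen g x) = gen g' x" by (rule Op_gen[OF B step.hyps(1) g'(1) step.hyps(2) g'(2)])
    show ?thesis
    proof (cases "\<exists>g''\<in>carrier G. A <#> coset g' \<subseteq> coset g''")
      case True
      then obtain g'' where g'': "g'' \<in> carrier G" "A <#> coset g' \<subseteq> coset g''" by blast
      show ?thesis
        unfolding Bg Op_gen[OF A g'(1) g''(1) step.hyps(2) g''(2)]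
        by (rule Op_gen[OF AB step.hyps(1) g''(1) step.hyps(2), symmetric]) (simp add: ABg g''(2))
    next
      case False
      then have "Op A (gen g' x) = \<zero>\<^bsub>L\<^esub>" by (intro Op_gen_zero[OF A g'(1) step.hyps(2)]) blast
      moreover have "Op (A <#> B) (gen g x) = \<zero>\<^bsub>L\<^esub>"
        using False by (intro Op_gen_zero[OF AB step.hyps(1,2)]) (auto simp: ABg)
      ultimately show ?thesis by (simp only: Bg)
    qed
  next
    case False
    have "\<not> A <#> B <#> coset g \<subseteq> coset g'" if g': "g' \<in> carrier G" for g'
    proof
      assume sub: "A <#> B <#> coset g \<subseteq> coset g'"
      obtain a where a: "a \<in> A" "a \<in> carrier G" using A by blast
      have "B <#> coset g \<subseteq> coset (inv a \<otimes> g')"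
      proof
        fix y assume y: "y \<in> B <#> coset g"
        have yG: "y \<in> carrier G" using y set_mult_closed[OF G(2,3)] by blast
        have "a \<otimes> y \<in> A <#> (B <#> coset g)" using a(1) y unfolding set_mult_def by blast
        then have "a \<otimes> y \<in> coset g'" using sub set_mult_assoc[OF G] by auto
        then show "y \<in> coset (inv a \<otimes> g')"
          using a(2) yG g' by (simp add: mem_coset inv_mult_group m_assoc)
      qed
      then show False using False a(2) g' by blast
    qed
    then have "Op (A <#> B) (gen g x) = \<zero>\<^bsub>L\<^esub>" by (rule Op_gen_zero[OF AB step.hyps(1,2)])
    moreover have "Op B (gen g x) = \<zero>\<^bsub>L\<^esub>" using False by (intro Op_gen_zero[OF B step.hyps(1,2)]) blast
    ultimately show ?thesis by (simp only: Op_zero[OF A])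
  qed
  moreover have "gen g x \<in> carrier L" by (rule gen_closed[OF step.hyps(1,2)])
  ultimately show ?case
    using step.IH by (simp only: Op_add[OF A] Op_add[OF B] Op_add[OF AB] Op_closed[OF B] step.hyps(3))
qed

lemma Op_finsum:
  assumes S: "ne S" and "f \<in> A \<rightarrow> carrier L"
  shows "Op S (finsum L f A) = finsum L (\<lambda>i. Op S (f i)) A"
  using assms(2)
proof (induction A rule: infinite_finite_induct)
  case (insert a A)
  then have "f \<in> A \<rightarrow> carrier L" "f a \<in> carrier L" by auto
  moreover have "(\<lambda>i. Op S (f i)) \<in> A \<rightarrow> carrier L" "Op S (f a) \<in> carrier L"
    using insert.prems Op_closed[OF S] by auto
  ultimately show ?case using insert
    by (simp add: L.finsum_insert Op_add[OF S] L.finsum_closed)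
qed (simp_all add: Op_zero[OF S])

text \<open>Conjugation is injective on the finite set \<open>H\<close>, so mapping \<open>H\<close>
  into itself already means mapping it onto itself.\<close>

lemma normalizerI:
  assumes y: "y \<in> carrier G" and sub: "\<And>h. h \<in> H \<Longrightarrow> inv y \<otimes> h \<otimes> y \<in> H"
  shows "y \<in> normalizer G H"
proof -
  let ?c = "\<lambda>h. inv y \<otimes> h \<otimes> y"
  have HG: "h \<in> carrier G" if "h \<in> H" for h using that by (rule H.mem_carrier)
  have "inj_on ?c H"
  proof (rule inj_onI)
    fix h k assume hk: "h \<in> H" "k \<in> H" "?c h = ?c k"
    then have "inv y \<otimes> h = inv y \<otimes> k" using y HG by simp
    then show "h = k" using hk y HG by simp
  qed
  then have im: "?c ` H = H" using sub finite_H by (intro endo_inj_surj) auto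
  have "y <# H #> inv y = (\<lambda>h. y \<otimes> h \<otimes> inv y) ` H"
    by (auto simp: l_coset_def r_coset_def)
  also have "\<dots> = (\<lambda>h. y \<otimes> ?c h \<otimes> inv y) ` H"
    by (subst im[symmetric]) (simp only: image_image)
  also have "\<dots> = H"
  proof -
    have "y \<otimes> ?c h \<otimes> inv y = h" if "h \<in> H" for h
      using y HG[OF that] by (simp add: m_assoc) (simp add: m_assoc[symmetric])
    then show ?thesis by simp
  qed
  finally show ?thesis using y by (simp add: normalizer_iff)
qed

text \<open>(nH)^-1 = H n^-1, and right and left cosets agree in the normalizer.\<close>

lemma set_inv_coset:
  assumes "n \<in> normalizer G H"
  shows "set_inv (coset n) = coset (inv n)"
proof -
  have n: "n \<in> carrier G" using assms by (simp add: normalizer_iff)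
  have inv_n: "inv n \<in> normalizer G H" using normalizer_subgroup assms by (rule subgroup.m_inv_closed)
  have "set_inv (coset n) = (\<lambda>h. inv h \<otimes> inv n) ` H"
  proof -
    have "inv (n \<otimes> h) = inv h \<otimes> inv n" if "h \<in> H" for h
      using n H.mem_carrier[OF that] by (rule inv_mult_group)
    then show ?thesis by (auto simp: SET_INV_def l_coset_def image_iff)
  qed
  also have "\<dots> = H #> inv n"
  proof -
    have "(\<lambda>h. inv h) ` H = H"
    proof
      show "(\<lambda>h. inv h) ` H \<subseteq> H" by auto
      have "h = inv (inv h)" if "h \<in> H" for h using H.mem_carrier[OF that] by simp
      then show "H \<subseteq> (\<lambda>h. inv h) ` H" using H.m_inv_closed by blast
    qed
    then have "H #> inv n = (\<Union>h\<in>(\<lambda>h. inv h) ` H. {h \<otimes> inv n})" by (simp add: r_coset_def)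
    then show ?thesis by auto
  qed
  finally show ?thesis by (simp only: normalizer_coset[OF inv_n])
qed

text \<open>A double coset \<open>D = H D H\<close> that does not annihilate \<open>L\<close> maps some coset into a coset;
  comparing cardinalities, both that coset and \<open>D\<close> then come from the normalizer.\<close>

lemma double_coset_cases:
  assumes D: "ne D" and left: "H <#> D = D" and right: "D <#> H = D"
  obtains (coset) n where "n \<in> normalizer G H" "D = coset n"
  | (zero) "\<And>u. u \<in> carrier L \<Longrightarrow> Op D u = \<zero>\<^bsub>L\<^esub>"
proof (cases "\<exists>y\<in>carrier G. \<exists>a\<in>carrier G. D <#> coset y \<subseteq> coset a")
  case True
  then obtain y a where ya: "y \<in> carrier G" "a \<in> carrier G" "D <#> coset y \<subseteq> coset a" by blast
  obtain d where d: "d \<in> D" "d \<in> carrier G" using D by blast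
  have DG: "D \<subseteq> carrier G" using D by blast
  have HG: "h \<in> carrier G" if "h \<in> H" for h using that by (rule H.mem_carrier)
  have Dy: "e \<otimes> y \<in> coset (d \<otimes> y)" if "e \<in> D" for e
  proof -
    have "e \<otimes> y \<in> coset a" "d \<otimes> y \<in> coset a"
      using that d(1) coset_self[OF ya(1)] ya(3) unfolding set_mult_def by blast+
    then show ?thesis using coset_eq[OF _ ya(2)] by simp
  qed
  have y: "y \<in> normalizer G H"
  proof (rule normalizerI[OF ya(1)])
    fix h assume h: "h \<in> H"
    \<comment> \<open>Since D = DH, both d and dh lie in D, so dy and dhy lie in the same left
      coset; their quotient is y^-1 h y.\<close>
    have "d \<otimes> h \<in> D" using right d(1) h unfolding set_mult_def by blast
    from Dy[OF this] have "inv (d \<otimes> y) \<otimes> (d \<otimes> h \<otimes> y) \<in> H"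
      using d(2) HG[OF h] ya(1) by (subst mem_coset[symmetric]) auto
    also have "inv (d \<otimes> y) \<otimes> (d \<otimes> h \<otimes> y) = inv y \<otimes> (inv d \<otimes> d) \<otimes> h \<otimes> y"
      using d(2) HG[OF h] ya(1) by (simp only: inv_mult_group m_assoc m_closed inv_closed)
    finally show "inv y \<otimes> h \<otimes> y \<in> H" using d(2) HG[OF h] ya(1) by simp
  qed
  have D_eq: "D = coset d"
  proof (rule coset_subset)
    show "D \<subseteq> coset d"
    proof
      fix e assume e: "e \<in> D"
      then have eG: "e \<in> carrier G" using DG by blast
      \<comment> \<open>As y normalizes \<open>H\<close>, the coset dyH equals dHy, and y can be
        cancelled on the right.\<close>
      have "e \<otimes> y \<in> coset d #> y" using Dy[OF e] coset_mult_normalizer[OF y d(2)] by simp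
      then obtain c where c: "c \<in> coset d" "e \<otimes> y = c \<otimes> y" by (auto simp: mem_r_coset)
      moreover have "c \<in> carrier G" using c(1) coset_carrier[OF d(2)] by blast
      ultimately show "e \<in> coset d" using eG ya(1) by simp
    qed
  qed (use d right in auto)
  \<comment> \<open>Now stability on the left is used: hd lies in HD = D = dH.\<close>
  have "inv d \<otimes> h \<otimes> d \<in> H" if h: "h \<in> H" for h
  proof -
    have "h \<otimes> d \<in> D" using left d(1) h unfolding set_mult_def by blast
    then have "h \<otimes> d \<in> coset d" using D_eq by simp
    then show ?thesis using d(2) HG[OF h] by (simp add: mem_coset m_assoc)
  qed
  then have "d \<in> normalizer G H" by (rule normalizerI[OF d(2)])
  then show thesis using D_eq by (rule coset)
next
  case False
  have "Op D u = \<zero>\<^bsub>L\<^esub>" if "u \<in> carrier L" for u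
    using that
  proof (induction rule: L_induct)
    case zero
    show ?case by (rule Op_zero[OF D])
  next
    case (step g x u)
    have "Op D (gen g x) = \<zero>\<^bsub>L\<^esub>" using False step.hyps(1) by (intro Op_gen_zero[OF D step.hyps(1,2)]) blast
    then show ?case using step by (simp add: Op_add[OF D] gen_closed)
  qed
  then show thesis by (rule zero)
qed

end

section \<open>Conjugates of \<open>H\<close> and the cosets they stabilize\<close>

context maximal_orbit_action
begin

definition conj_H :: "'g \<Rightarrow> 'g set" where
  "conj_H g = inv g <# H #> g"

lemma conj_H_set_mult: "conj_H g = {inv g} <#> H <#> {g}"
  by (simp only: conj_H_def l_coset_eq_set_mult r_coset_eq_set_mult)

lemma conj_H_image: "conj_H g = (\<lambda>h. inv g \<otimes> h \<otimes> g) ` H"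
  by (auto simp: conj_H_def l_coset_def r_coset_def)

lemma ne_conj_H: "g \<in> carrier G \<Longrightarrow> ne (conj_H g)"
  unfolding conj_H_def by (intro ne_r_coset ne_l_coset ne_H inv_closed)

lemma mem_conj_H:
  assumes "x \<in> carrier G" "g \<in> carrier G"
  shows "x \<in> conj_H g \<longleftrightarrow> g \<otimes> x \<otimes> inv g \<in> H"
proof
  assume "x \<in> conj_H g"
  then obtain h where h: "h \<in> H" "x = inv g \<otimes> h \<otimes> g" by (auto simp: conj_H_image)
  have hG: "h \<in> carrier G" using h(1) by (rule H.mem_carrier)
  have "g \<otimes> x \<otimes> inv g = (g \<otimes> inv g) \<otimes> h \<otimes> (g \<otimes> inv g)"
    unfolding h(2) using hG assms(2) by (simp only: m_assoc m_closed inv_closed)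
  then show "g \<otimes> x \<otimes> inv g \<in> H" using h(1) hG assms(2) by simp
next
  assume h: "g \<otimes> x \<otimes> inv g \<in> H"
  have "inv g \<otimes> (g \<otimes> x \<otimes> inv g) \<otimes> g = (inv g \<otimes> g) \<otimes> x \<otimes> (inv g \<otimes> g)"
    using assms by (simp only: m_assoc m_closed inv_closed)
  also have "\<dots> = x" using assms by simp
  finally have "x = inv g \<otimes> (g \<otimes> x \<otimes> inv g) \<otimes> g" by (rule sym)
  then show "x \<in> conj_H g" unfolding conj_H_image using h by (rule image_eqI)
qed

lemma card_conj_H:
  assumes "g \<in> carrier G"
  shows "card (conj_H g) = card H"
  unfolding conj_H_image
proof (rule card_image, rule inj_onI)
  fix h k assume "h \<in> H" "k \<in> H" "inv g \<otimes> h \<otimes> g = inv g \<otimes> k \<otimes> g"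
  then show "h = k" using assms by simp
qed

text \<open>Conjugates of a finite subgroup all have the same cardinality.\<close>

lemma conj_H_subset_eq:
  assumes "g \<in> carrier G" "g' \<in> carrier G" "conj_H g \<subseteq> conj_H g'"
  shows "conj_H g = conj_H g'"
proof (rule card_subset_eq)
  show "finite (conj_H g')" by (simp add: conj_H_image finite_H)
qed (use assms card_conj_H in auto)

text \<open>The conjugate contains \<one>, so the target coset must be aH itself. The conjugate then
  lies in the stabilizer a H a^-1 of aH, which is \<open>conj_H (inv a)\<close>, and equals it by
  cardinality.\<close>

lemma conj_H_stabilizes_coset:
  assumes "g \<in> carrier G" "a \<in> carrier G" "a' \<in> carrier G" "conj_H g <#> coset a \<subseteq> coset a'"
  shows "conj_H g = conj_H (inv a)"
proof (rule conj_H_subset_eq)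
  have mult: "x \<otimes> a \<in> coset a'" if "x \<in> conj_H g" for x
    using that coset_self[OF assms(2)] assms(4) unfolding set_mult_def by blast
  have "\<one> \<in> conj_H g" using assms(1) by (simp add: mem_conj_H)
  then have "a \<in> coset a'" using mult assms(2) by force
  then have eq: "coset a = coset a'" by (rule coset_eq[OF _ assms(3)])
  show "conj_H g \<subseteq> conj_H (inv a)"
  proof
    fix x assume x: "x \<in> conj_H g"
    then have xG: "x \<in> carrier G" using ne_conj_H[OF assms(1)] by blast
    then have "inv a \<otimes> (x \<otimes> a) \<in> H" using mult[OF x] eq assms(2) by (simp add: mem_coset[symmetric])
    then show "x \<in> conj_H (inv a)" using xG assms(2) by (simp add: mem_conj_H m_assoc)
  qed
qed (use assms in auto)

lemma conj_H_inv_coset: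
  assumes "a \<in> carrier G"
  shows "conj_H (inv a) <#> coset a \<subseteq> coset a"
proof
  fix y assume "y \<in> conj_H (inv a) <#> coset a"
  then obtain x h where x: "x \<in> conj_H (inv a)" "h \<in> H" "y = x \<otimes> (a \<otimes> h)"
    unfolding set_mult_def l_coset_def by blast
  have G: "x \<in> carrier G" "h \<in> carrier G"
    using x ne_conj_H[of "inv a"] assms H.mem_carrier by auto
  have "inv a \<otimes> x \<otimes> a \<in> H" using x(1) G assms by (simp add: mem_conj_H)
  then have "inv a \<otimes> x \<otimes> a \<otimes> h \<in> H" using x(2) by (rule H.m_closed)
  then show "y \<in> coset a" using x(3) G assms by (simp add: mem_coset m_assoc)
qed

lemma set_inv_mult:
  assumes "A \<subseteq> carrier G" "B \<subseteq> carrier G"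
  shows "set_inv (A <#> B) = set_inv B <#> set_inv A"
proof -
  have "inv (a \<otimes> b) = inv b \<otimes> inv a" if "a \<in> A" "b \<in> B" for a b
    using that assms by (intro inv_mult_group) auto
  then show ?thesis by (force simp: SET_INV_def set_mult_def)
qed

lemma set_inv_singleton: "set_inv {g} = {inv g}"
  by (simp add: SET_INV_def)

lemma set_inv_H: "set_inv H = H"
proof
  show "set_inv H \<subseteq> H" by (auto simp: SET_INV_def)
  have "h = inv (inv h)" if "h \<in> H" for h using H.mem_carrier[OF that] by simp
  then show "H \<subseteq> set_inv H" using H.m_inv_closed unfolding SET_INV_def by blast
qed

lemma H_mult_H: "H <#> H = H"
  by (rule subgroup_mult_id[OF H.subgroup_axioms])

lemma H_mult_coset_normalizer:
  assumes "n \<in> normalizer G H"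
  shows "H <#> coset n = coset n"
proof -
  have "{n} \<subseteq> carrier G" using assms by (simp add: normalizer_iff)
  then have "H <#> (H <#> {n}) = H <#> {n}"
    by (simp only: set_mult_assoc[OF H.subset H.subset, symmetric] H_mult_H)
  then show ?thesis
    by (simp only: normalizer_coset[OF assms, symmetric] r_coset_eq_set_mult)
qed

end

section \<open>The form\<close>

locale factorpower_form = factorpower_module G M \<phi> H U \<rho>
  for G :: "('g, 'z) monoid_scheme" (structure) and M :: "'m set" and \<phi> and H
    and U :: "(complex, 'x) module" and \<rho> +
  fixes Hs :: "'g set list" and gs :: "nat \<Rightarrow> 'g"
    and b :: "('g, 'x) L_elem \<Rightarrow> ('g, 'x) L_elem \<Rightarrow> complex"
  assumes distinct_Hs: "distinct Hs"
    and set_Hs: "set Hs = {inv g <# H #> g | g. g \<in> carrier G}"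
    and gs_closed: "i < length Hs \<Longrightarrow> gs i \<in> carrier G"
    and Hs_nth: "i < length Hs \<Longrightarrow> Hs ! i = inv (gs i) <# H #> gs i"
    and b: "hermitian_scalar_product (L_module G M \<phi> H U \<rho>\<lparr>carrier := idem_image G M \<phi> H U \<rho> H\<rparr>) b"
begin

abbreviation "k \<equiv> length Hs"
abbreviation "V1 \<equiv> idem_image G M \<phi> H U \<rho> H"
abbreviation "\<beta> \<equiv> averaged_form G M \<phi> H U \<rho> b"

section \<open>Orthogonal decomposition by the idempotents of the conjugates\<close>

lemma Hs_conj: "i < k \<Longrightarrow> Hs ! i = conj_H (gs i)"
  by (simp add: Hs_nth conj_H_def)

lemma ne_Hs: "i < k \<Longrightarrow> ne (Hs ! i)"
  using ne_conj_H[OF gs_closed] Hs_conj by simp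

lemma ne_H_gs: "i < k \<Longrightarrow> ne (H #> gs i)"
  using ne_r_coset[OF gs_closed ne_H] .

text \<open>Only the stabilizer a H a^-1 of aH, among all conjugates, sends aH into a single coset.
  The spanning tensors are therefore common eigenvectors of these idempotents, with eigenvalues 0
  and 1.\<close>

lemma Op_Hs_gen:
  assumes "i < k" "a \<in> carrier G" "x \<in> carrier U"
  shows "Op (Hs ! i) (gen a x) = (if Hs ! i = conj_H (inv a) then gen a x else \<zero>\<^bsub>L\<^esub>)"
proof (cases "Hs ! i = conj_H (inv a)")
  case True
  then have "Op (Hs ! i) (gen a x) = gen a x"
    using conj_H_inv_coset[OF assms(2)] by (intro Op_gen[OF ne_Hs[OF assms(1)] assms(2,2,3)]) simp
  then show ?thesis using True by simp
next
  case False
  then have "\<not> Hs ! i <#> coset a \<subseteq> coset a'" if "a' \<in> carrier G" for a'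
    using conj_H_stabilizes_coset[OF gs_closed[OF assms(1)] assms(2) that] Hs_conj[OF assms(1)] by auto
  then have "Op (Hs ! i) (gen a x) = \<zero>\<^bsub>L\<^esub>"
    by (rule Op_gen_zero[OF ne_Hs[OF assms(1)] assms(2,3)])
  then show ?thesis using False by simp
qed

lemma Op_Hs_Hs:
  assumes "i < k" "j < k" "u \<in> carrier L"
  shows "Op (Hs ! i) (Op (Hs ! j) u) = (if i = j then Op (Hs ! j) u else \<zero>\<^bsub>L\<^esub>)"
  using assms(3)
proof (induction rule: L_induct)
  case zero
  show ?case by (simp add: Op_zero[OF ne_Hs[OF assms(1)]] Op_zero[OF ne_Hs[OF assms(2)]])
next
  case (step g x u)
  note i = ne_Hs[OF assms(1)] and j = ne_Hs[OF assms(2)]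
  have gen: "gen g x \<in> carrier L" by (rule gen_closed[OF step.hyps(1,2)])
  have "Hs ! i = Hs ! j \<longleftrightarrow> i = j" using assms(1,2) distinct_Hs by (simp add: nth_eq_iff_index_eq)
  then have "Op (Hs ! i) (Op (Hs ! j) (gen g x)) = (if i = j then Op (Hs ! j) (gen g x) else \<zero>\<^bsub>L\<^esub>)"
    using Op_Hs_gen[OF assms(1) step.hyps(1,2)] Op_Hs_gen[OF assms(2) step.hyps(1,2)] Op_zero[OF i]
    by (cases "Hs ! j = conj_H (inv g)") auto
  then show ?case
    using step.IH step.hyps(3) gen
    by (simp add: Op_add[OF i] Op_add[OF j] Op_closed[OF j])
qed

lemma sum_Hs:
  assumes "u \<in> carrier L"
  shows "finsum L (\<lambda>i. Op (Hs ! i) u) {..<k} = u"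
  using assms
proof (induction rule: L_induct)
  case zero
  have "finsum L (\<lambda>i. Op (Hs ! i) \<zero>\<^bsub>L\<^esub>) {..<k} = finsum L (\<lambda>i. \<zero>\<^bsub>L\<^esub>) {..<k}"
    by (rule L.finsum_cong') (simp_all add: Op_zero[OF ne_Hs])
  then show ?case by simp
next
  case (step g x u)
  have gen: "gen g x \<in> carrier L" by (rule gen_closed[OF step.hyps(1,2)])
  \<comment> \<open>The stabilizer of gH is listed, and \<open>distinct_Hs\<close> lets it occur
    only once: exactly one summand survives.\<close>
  have "conj_H (inv g) \<in> set Hs"
    unfolding set_Hs conj_H_def using inv_closed[OF step.hyps(1)] by blast
  then obtain i where i: "i < k" "Hs ! i = conj_H (inv g)" by (auto simp: in_set_conv_nth)
  have "finsum L (\<lambda>j. Op (Hs ! j) (gen g x)) {..<k} =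
      finsum L (\<lambda>j. if i = j then gen g x else \<zero>\<^bsub>L\<^esub>) {..<k}"
  proof (rule L.finsum_cong')
    fix j assume "j \<in> {..<k}"
    then have "j < k" by simp
    moreover have "Hs ! j = conj_H (inv g) \<longleftrightarrow> i = j"
      using i \<open>j < k\<close> distinct_Hs by (metis nth_eq_iff_index_eq)
    ultimately show "Op (Hs ! j) (gen g x) = (if i = j then gen g x else \<zero>\<^bsub>L\<^esub>)"
      using step.hyps by (simp add: Op_Hs_gen)
  qed (use gen in auto)
  also have "\<dots> = gen g x"
    using i gen by (intro L.finsum_singleton) auto
  finally have sum_gen: "finsum L (\<lambda>j. Op (Hs ! j) (gen g x)) {..<k} = gen g x" .
  have "finsum L (\<lambda>i. Op (Hs ! i) (gen g x \<oplus>\<^bsub>L\<^esub> u)) {..<k} =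
      finsum L (\<lambda>i. Op (Hs ! i) (gen g x) \<oplus>\<^bsub>L\<^esub> Op (Hs ! i) u) {..<k}"
    using gen step.hyps(3)
    by (intro L.finsum_cong') (auto simp: Op_add[OF ne_Hs] Op_closed[OF ne_Hs])
  also have "\<dots> = gen g x \<oplus>\<^bsub>L\<^esub> u"
    using gen step.hyps(3) step.IH sum_gen Op_closed[OF ne_Hs]
    by (subst L.finsum_addf) auto
  finally show ?case .
qed

text \<open>The definite description in \<open>components\<close> is justified here: applying the
  i-th idempotent to any admissible decomposition isolates its i-th summand. The restriction to
  \<open>{..<k}\<close> matches the extensionality demanded by \<open>PiE\<close>.\<close>

lemma components_L:
  assumes v: "v \<in> carrier L"
  shows "components L k (\<lambda>i. idem_image G M \<phi> H U \<rho> (Hs ! i)) v = (\<lambda>i\<in>{..<k}. Op (Hs ! i) v)"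
  unfolding components_def
proof (rule the_equality, intro conjI)
  show "(\<lambda>i\<in>{..<k}. Op (Hs ! i) v) \<in> (\<Pi>\<^sub>E i\<in>{..<k}. idem_image G M \<phi> H U \<rho> (Hs ! i))"
    using v by (auto simp: idem_image_def)
  have "finsum L (\<lambda>i\<in>{..<k}. Op (Hs ! i) v) {..<k} = finsum L (\<lambda>i. Op (Hs ! i) v) {..<k}"
    by (rule L.finsum_cong') (use v in \<open>auto simp: Op_closed[OF ne_Hs]\<close>)
  then show "v = finsum L (\<lambda>i\<in>{..<k}. Op (Hs ! i) v) {..<k}" by (simp only: sum_Hs[OF v])
next
  fix u assume u: "u \<in> (\<Pi>\<^sub>E i\<in>{..<k}. idem_image G M \<phi> H U \<rho> (Hs ! i)) \<and> v = finsum L u {..<k}"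
  have fix_u: "u j \<in> carrier L \<and> Op (Hs ! i) (u j) = (if i = j then u j else \<zero>\<^bsub>L\<^esub>)"
    if "i < k" "j < k" for i j
  proof -
    have "u j \<in> idem_image G M \<phi> H U \<rho> (Hs ! j)" using u that by auto
    then obtain c where "c \<in> carrier L" "u j = Op (Hs ! j) c" by (auto simp: idem_image_def)
    then show ?thesis using that by (simp add: Op_Hs_Hs Op_closed[OF ne_Hs])
  qed
  show "u = (\<lambda>i\<in>{..<k}. Op (Hs ! i) v)"
  proof (rule extensionalityI)
    show "u \<in> extensional {..<k}" using u by (auto simp: PiE_def)
    fix i assume "i \<in> {..<k}"
    then have i: "i < k" by simp
    have "Op (Hs ! i) v = finsum L (\<lambda>j. Op (Hs ! i) (u j)) {..<k}"
      using u fix_u by (simp add: Op_finsum[OF ne_Hs[OF i]])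
    also have "\<dots> = finsum L (\<lambda>j. if i = j then u j else \<zero>\<^bsub>L\<^esub>) {..<k}"
      using fix_u i by (intro L.finsum_cong') auto
    also have "\<dots> = u i" using i fix_u by (intro L.finsum_singleton) auto
    finally show "u i = (\<lambda>i\<in>{..<k}. Op (Hs ! i) v) i" using i by simp
  qed auto
qed

section \<open>The averaged form on the image of the idempotent of \<open>H\<close>\<close>

lemma mem_V1: "v \<in> V1 \<longleftrightarrow> v \<in> carrier L \<and> Op H v = v"
proof
  assume "v \<in> V1"
  then obtain c where "c \<in> carrier L" "v = Op H c" by (auto simp: idem_image_def)
  then show "v \<in> carrier L \<and> Op H v = v"
    using Op_mult[OF ne_H ne_H, of c] Op_closed[OF ne_H] by (simp add: H_mult_H)
next
  assume "v \<in> carrier L \<and> Op H v = v"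
  then show "v \<in> V1" unfolding idem_image_def by (metis imageI)
qed

lemma Op_V1: "ne C \<Longrightarrow> H <#> C = C \<Longrightarrow> v \<in> carrier L \<Longrightarrow> Op C v \<in> V1"
  using Op_mult[OF ne_H, of C v] Op_closed[of C v] by (simp add: mem_V1)

lemma V1_zero: "\<zero>\<^bsub>L\<^esub> \<in> V1"
  by (simp add: mem_V1 Op_zero[OF ne_H])

lemma V1_add: "v \<in> V1 \<Longrightarrow> w \<in> V1 \<Longrightarrow> v \<oplus>\<^bsub>L\<^esub> w \<in> V1"
  by (simp add: mem_V1 Op_add[OF ne_H])

lemma V1_closed: "v \<in> V1 \<Longrightarrow> v \<in> carrier L"
  by (simp add: mem_V1)

lemma V1_finsum: "f \<in> A \<rightarrow> V1 \<Longrightarrow> finsum L f A \<in> V1"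
proof (induction A rule: infinite_finite_induct)
  case (insert a A)
  then have "f \<in> A \<rightarrow> V1" "f a \<in> V1" by auto
  moreover from this have "f \<in> A \<rightarrow> carrier L" "f a \<in> carrier L" by (auto intro: V1_closed)
  ultimately show ?case using insert by (simp add: L.finsum_insert V1_add)
qed (simp_all add: V1_zero)

lemma NQ_cases:
  assumes "C \<in> carrier NQ"
  obtains n where "n \<in> normalizer G H" "n \<in> carrier G" "C = coset n"
  using assms by (auto simp: carrier_normalizer_quotient normalizer_iff)

lemma ne_NQ: "C \<in> carrier NQ \<Longrightarrow> ne C"
  by (erule NQ_cases, hypsubst, rule ne_coset)

lemma H_mult_NQ: "C \<in> carrier NQ \<Longrightarrow> H <#> C = C"
  by (erule NQ_cases) (simp only: H_mult_coset_normalizer)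

lemma finite_NQ: "finite (carrier NQ)"
proof -
  have "normalizer G H \<subseteq> carrier G" by (auto simp: normalizer_iff)
  then show ?thesis using finite_G by (simp add: carrier_normalizer_quotient finite_subset)
qed

lemma Op_NQ_V1: "C \<in> carrier NQ \<Longrightarrow> v \<in> V1 \<Longrightarrow> Op C v \<in> V1"
  by (intro Op_V1 ne_NQ H_mult_NQ V1_closed)

lemmas b_unfolded = b[unfolded hermitian_scalar_product_def]

lemma b_add: "u \<in> V1 \<Longrightarrow> v \<in> V1 \<Longrightarrow> w \<in> V1 \<Longrightarrow> b (u \<oplus>\<^bsub>L\<^esub> v) w = b u w + b v w"
  using b_unfolded[THEN conjunct1] by simp

lemma b_smult: "v \<in> V1 \<Longrightarrow> w \<in> V1 \<Longrightarrow> b (c \<odot>\<^bsub>L\<^esub> v) w = c * b v w"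
  using b_unfolded[THEN conjunct2, THEN conjunct1] by simp

lemma b_sym: "v \<in> V1 \<Longrightarrow> w \<in> V1 \<Longrightarrow> b w v = cnj (b v w)"
  by (rule b_unfolded[THEN conjunct2, THEN conjunct2, THEN conjunct1, THEN bspec, THEN bspec]) simp_all

lemma b_pos: "v \<in> V1 \<Longrightarrow> v \<noteq> \<zero>\<^bsub>L\<^esub> \<Longrightarrow> Re (b v v) > 0"
  using b_unfolded[THEN conjunct2, THEN conjunct2, THEN conjunct2] by simp

lemma b_zero: "w \<in> V1 \<Longrightarrow> b \<zero>\<^bsub>L\<^esub> w = 0"
  using b_add[of "\<zero>\<^bsub>L\<^esub>" "\<zero>\<^bsub>L\<^esub>" w] V1_zero by simp

lemma b_nonneg: "v \<in> V1 \<Longrightarrow> Re (b v v) \<ge> 0"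
  using b_pos[of v] b_zero[of v] by (cases "v = \<zero>\<^bsub>L\<^esub>") auto

lemma form_add:
  assumes "u \<in> V1" "v \<in> V1" "w \<in> V1"
  shows "\<beta> (u \<oplus>\<^bsub>L\<^esub> v) w = \<beta> u w + \<beta> v w"
  unfolding averaged_form_def sum.distrib[symmetric]
proof (rule sum.cong[OF refl])
  fix C assume C: "C \<in> carrier NQ"
  then have "ne C" by (rule ne_NQ)
  then show "b (Op C (u \<oplus>\<^bsub>L\<^esub> v)) (Op C w) = b (Op C u) (Op C w) + b (Op C v) (Op C w)"
    using assms by (simp add: Op_add V1_closed b_add Op_NQ_V1[OF C])
qed

lemma form_smult:
  assumes "v \<in> V1" "w \<in> V1"
  shows "\<beta> (c \<odot>\<^bsub>L\<^esub> v) w = c * \<beta> v w"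
  unfolding averaged_form_def sum_distrib_left
proof (rule sum.cong[OF refl])
  fix C assume C: "C \<in> carrier NQ"
  then have "ne C" by (rule ne_NQ)
  then show "b (Op C (c \<odot>\<^bsub>L\<^esub> v)) (Op C w) = c * b (Op C v) (Op C w)"
    using assms by (simp add: Op_smult V1_closed b_smult Op_NQ_V1[OF C])
qed

lemma form_sym: "v \<in> V1 \<Longrightarrow> w \<in> V1 \<Longrightarrow> \<beta> w v = cnj (\<beta> v w)"
  unfolding averaged_form_def cnj_sum by (intro sum.cong[OF refl] b_sym Op_NQ_V1)

lemma form_zero: "w \<in> V1 \<Longrightarrow> \<beta> \<zero>\<^bsub>L\<^esub> w = 0"
  using form_add[of "\<zero>\<^bsub>L\<^esub>" "\<zero>\<^bsub>L\<^esub>" w] V1_zero by simp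

lemma form_nonneg: "v \<in> V1 \<Longrightarrow> Re (\<beta> v v) \<ge> 0"
  unfolding averaged_form_def by (simp add: sum_nonneg b_nonneg Op_NQ_V1)

lemma H_in_NQ: "H \<in> carrier NQ"
proof -
  have "\<one> \<in> normalizer G H" using normalizer_subgroup by (rule subgroup.one_closed)
  then have "coset \<one> \<in> carrier NQ" unfolding carrier_normalizer_quotient by (rule imageI)
  then show ?thesis by (simp add: lcos_mult_one H.subset)
qed

text \<open>The identity coset \<open>H\<close> fixes \<open>v\<close> and contributes the positive
  term \<open>b v v\<close>; all other terms of the average are nonnegative.\<close>

lemma form_pos:
  assumes "v \<in> V1" "v \<noteq> \<zero>\<^bsub>L\<^esub>"
  shows "Re (\<beta> v v) > 0"
proof -
  have "0 < (\<Sum>C\<in>carrier NQ. Re (b (Op C v) (Op C v)))"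
    using finite_NQ H_in_NQ
  proof (rule sum_pos2)
    show "0 < Re (b (Op H v) (Op H v))" using assms b_pos by (simp add: mem_V1)
  qed (simp add: b_nonneg Op_NQ_V1 assms)
  then show ?thesis by (simp add: averaged_form_def)
qed

lemma form_sum_left:
  assumes "finite A" "f \<in> A \<rightarrow> V1" "w \<in> V1"
  shows "\<beta> (finsum L f A) w = (\<Sum>i\<in>A. \<beta> (f i) w)"
  using assms(1,2)
proof (induction A rule: finite_induct)
  case empty
  then show ?case by (simp add: form_zero assms(3))
next
  case (insert a A)
  have f: "f \<in> A \<rightarrow> V1" "f a \<in> V1" using insert.prems by auto
  then have "f \<in> A \<rightarrow> carrier L" "f a \<in> carrier L" by (auto intro: V1_closed)
  then show ?case using insert f V1_finsum[OF f(1)]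
    by (simp add: L.finsum_insert form_add assms(3))
qed

lemma form_sum_right:
  assumes "finite A" "f \<in> A \<rightarrow> V1" "w \<in> V1"
  shows "\<beta> w (finsum L f A) = (\<Sum>i\<in>A. \<beta> w (f i))"
proof -
  have "\<beta> w (finsum L f A) = cnj (\<Sum>i\<in>A. \<beta> (f i) w)"
    using form_sum_left[OF assms] form_sym[OF V1_finsum[OF assms(2)] assms(3)] by simp
  also have "\<dots> = (\<Sum>i\<in>A. \<beta> w (f i))"
    unfolding cnj_sum using assms by (intro sum.cong[OF refl] form_sym[symmetric]) auto
  finally show ?thesis .
qed

text \<open>Replace C by Cn in the average on the right; n n^-1 cancels in the second argument. Both
  translations preserve N(H)/H and are mutually inverse.\<close>

lemma form_adjoint_coset:
  assumes n: "n \<in> normalizer G H" and v: "v \<in> V1" and w: "w \<in> V1"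
  shows "\<beta> (Op (coset n) v) w = \<beta> v (Op (coset (inv n)) w)"
proof -
  have inv_n: "inv n \<in> normalizer G H" using normalizer_subgroup n by (rule subgroup.m_inv_closed)
  have nG: "n \<in> carrier G" using n by (simp add: normalizer_iff)
  have mult: "coset a <#> coset c = coset (a \<otimes> c)" "coset a <#> coset c \<in> carrier NQ"
    if "a \<in> normalizer G H" "c \<in> normalizer G H" for a c
  proof -
    show eq: "coset a <#> coset c = coset (a \<otimes> c)"
      using that by (intro coset_mult_coset_normalizer) (auto simp: normalizer_iff)
    show "coset a <#> coset c \<in> carrier NQ"
      unfolding eq carrier_normalizer_quotient
      using subgroup.m_closed[OF normalizer_subgroup that] by (rule imageI)
  qed
  have norm_mult: "a \<otimes> c \<in> normalizer G H" if "a \<in> normalizer G H" "c \<in> normalizer G H" for a c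
    using subgroup.m_closed[OF normalizer_subgroup that] .
  have cancel: "C <#> coset n <#> coset (inv n) = C" "C <#> coset (inv n) <#> coset n = C"
    "C <#> coset n \<in> carrier NQ" "C <#> coset (inv n) \<in> carrier NQ" if C: "C \<in> carrier NQ" for C
  proof -
    obtain a where a: "a \<in> normalizer G H" "C = coset a" and aG: "a \<in> carrier G"
      using C by (rule NQ_cases)
    show "C <#> coset n <#> coset (inv n) = C" "C <#> coset (inv n) <#> coset n = C"
      using a n inv_n aG nG by (simp_all add: mult(1) norm_mult m_assoc)
    show "C <#> coset n \<in> carrier NQ" "C <#> coset (inv n) \<in> carrier NQ"
      unfolding a(2) by (rule mult(2)[OF a(1)], fact)+
  qed
  have Op_C: "Op C (Op (coset c) u) = Op (C <#> coset c) u"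
    if "C \<in> carrier NQ" "c \<in> carrier G" "u \<in> V1" for C c u
    by (rule Op_mult[OF ne_NQ[OF that(1)] ne_coset[OF that(2)] V1_closed[OF that(3)]])
  have inv_nG: "inv n \<in> carrier G" using nG by simp
  show ?thesis
    unfolding averaged_form_def
  proof (rule sum.reindex_bij_witness[of _ "\<lambda>C. C <#> coset (inv n)" "\<lambda>C. C <#> coset n"])
    fix C assume C: "C \<in> carrier NQ"
    show "b (Op (C <#> coset n) v) (Op (C <#> coset n) (Op (coset (inv n)) w)) =
        b (Op C (Op (coset n) v)) (Op C w)"
      by (simp only: Op_C[OF cancel(3)[OF C] inv_nG w] Op_C[OF C nG v] cancel(1)[OF C])
  qed (rule cancel, assumption)+
qed

text \<open>That D annihilates \<open>L\<close> does not say the same of D^-1, so the dichotomy is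
  applied to both. If D^-1 is a coset from the normalizer, so is D, and the coset case applies
  again; otherwise both sides are zero.\<close>

lemma form_adjoint:
  assumes D: "ne D" "H <#> D = D" "D <#> H = D" and v: "v \<in> V1" and w: "w \<in> V1"
  shows "\<beta> (Op D v) w = \<beta> v (Op (set_inv D) w)"
proof -
  have DG: "D \<subseteq> carrier G" using D by blast
  have D': "ne (set_inv D)" "H <#> set_inv D = set_inv D" "set_inv D <#> H = set_inv D"
    using ne_inv[OF D(1)] set_inv_mult[OF DG H.subset] set_inv_mult[OF H.subset DG] D(2,3)
    by (simp_all add: set_inv_H)
  have invol: "set_inv (set_inv D) = D"
  proof -
    have "inv (inv d) = d" if "d \<in> D" for d using that DG by auto
    then show ?thesis by (simp add: SET_INV_def)
  qed
  show ?thesis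
  proof (cases rule: double_coset_cases[OF D])
    case (1 n)
    then show ?thesis using form_adjoint_coset[OF 1(1) v w] by (simp add: set_inv_coset)
  next
    case 2
    note zero = this
    have left: "\<beta> (Op D v) w = 0" using zero[OF V1_closed[OF v]] form_zero[OF w] by simp
    show ?thesis
    proof (cases rule: double_coset_cases[OF D'])
      case (1 n)
      then have "D = coset (inv n)" using invol set_inv_coset by metis
      then have "\<beta> (Op D v) w = \<beta> v (Op (coset (inv (inv n))) w)"
        using form_adjoint_coset[OF subgroup.m_inv_closed[OF normalizer_subgroup 1(1)] v w] by simp
      then show ?thesis using 1 by (simp add: normalizer_iff)
    next
      case 2
      have "\<beta> v (Op (set_inv D) w) = cnj (\<beta> \<zero>\<^bsub>L\<^esub> v)"
        using 2[OF V1_closed[OF w]] form_sym[OF V1_zero v] by simp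
      then show ?thesis using left form_zero[OF v] by simp
    qed
  qed
qed

section \<open>Coordinates in V_1 and the matrix of an operator\<close>

abbreviation "p i \<equiv> Op (H #> gs i)"

lemma H_r_coset: "H #> g = H <#> {g}"
  by (rule r_coset_eq_set_mult)

lemma p_V1: "i < k \<Longrightarrow> v \<in> carrier L \<Longrightarrow> p i v \<in> V1"
  using gs_closed[of i]
  by (intro Op_V1 ne_H_gs)
    (simp_all add: H_r_coset set_mult_assoc[symmetric] H.subset H_mult_H)

text \<open>g_i (g_i^-1 H g_i) = H g_i: the coordinate is the i-th component transported to V_1, as
  in the construction of the form.\<close>

lemma p_eq:
  assumes "i < k" "v \<in> carrier L"
  shows "Op {gs i} (Op (Hs ! i) v) = p i v"
proof -
  note g = gs_closed[OF assms(1)]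
  have "{gs i} <#> Hs ! i = gs i <# (inv (gs i) <# H) #> gs i"
    using g coset_carrier[of "inv (gs i)"]
    by (simp add: Hs_nth[OF assms(1)] singleton_mult coset_assoc)
  also have "\<dots> = H #> gs i" using g H.subset by (simp add: lcos_m_assoc lcos_mult_one)
  finally show ?thesis using Op_mult[of "{gs i}" "Hs ! i" v] ne_Hs[OF assms(1)] g assms(2) by simp
qed

text \<open>Recovers the i-th component from its coordinate, so the coordinates are jointly
  injective; this yields definiteness.\<close>

lemma Op_Hs_from_p:
  assumes "i < k" "v \<in> carrier L"
  shows "Op (Hs ! i) v = Op {inv (gs i)} (p i v)"
proof -
  note g = gs_closed[OF assms(1)]
  have "{inv (gs i)} <#> (H #> gs i) = Hs ! i"
    using g H.subset by (simp add: Hs_nth[OF assms(1)] singleton_mult coset_assoc)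
  then show ?thesis using Op_mult[of "{inv (gs i)}" "H #> gs i" v] ne_H_gs[OF assms(1)] g assms(2) by simp
qed

text \<open>The (j, i) entry of the matrix of S in the coordinates \<open>p\<close>. The outer
  factors \<open>H\<close> make it stable on both sides, as \<open>double_coset_cases\<close>
  requires.\<close>

definition dbl :: "nat \<Rightarrow> nat \<Rightarrow> 'g set \<Rightarrow> 'g set" where
  "dbl j i S = H <#> ({gs j} <#> S <#> {inv (gs i)}) <#> H"

lemma dbl_props:
  assumes "ne S" "i < k" "j < k"
  shows "ne (dbl j i S)" "H <#> dbl j i S = dbl j i S" "dbl j i S <#> H = dbl j i S"
    "set_inv (dbl j i S) = dbl i j (set_inv S)"
proof -
  have G: "{gs j} \<subseteq> carrier G" "S \<subseteq> carrier G" "{inv (gs i)} \<subseteq> carrier G"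
    using assms gs_closed by auto
  let ?N = "{gs j} <#> S <#> {inv (gs i)}"
  have N: "ne ?N" using assms gs_closed by (intro ne_mult) auto
  then have NG: "?N \<subseteq> carrier G" by blast
  note closed = set_mult_closed[OF H.subset NG] set_mult_closed[OF NG H.subset]
  show "ne (dbl j i S)" unfolding dbl_def by (intro ne_mult ne_H N)
  show "H <#> dbl j i S = dbl j i S"
    unfolding dbl_def using closed
    by (simp only: set_mult_assoc[OF H.subset closed(1) H.subset, symmetric]
        set_mult_assoc[OF H.subset H.subset NG, symmetric] H_mult_H)
  show "dbl j i S <#> H = dbl j i S"
    unfolding dbl_def
    by (simp only: set_mult_assoc[OF closed(1) H.subset H.subset] H_mult_H)
  have "set_inv ?N = {gs i} <#> (set_inv S <#> {inv (gs j)})"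
    using gs_closed[OF assms(2)]
    by (simp add: set_inv_mult[OF set_mult_closed[OF G(1,2)] G(3)] set_inv_mult[OF G(1,2)]
        set_inv_singleton)
  also have "\<dots> = {gs i} <#> set_inv S <#> {inv (gs j)}"
    using ne_inv[OF assms(1)] gs_closed[OF assms(2)] gs_closed[OF assms(3)]
    by (intro set_mult_assoc[symmetric]) auto
  finally have inv_N: "set_inv ?N = {gs i} <#> set_inv S <#> {inv (gs j)}" .
  then have invG: "{gs i} <#> set_inv S <#> {inv (gs j)} \<subseteq> carrier G"
    using ne_inv[OF N] by simp
  show "set_inv (dbl j i S) = dbl i j (set_inv S)"
    unfolding dbl_def set_inv_mult[OF closed(1) H.subset] set_inv_mult[OF H.subset NG] set_inv_H inv_N
    by (rule set_mult_assoc[OF H.subset invG H.subset, symmetric])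
qed

text \<open>Insert the decomposition of the identity into the idempotents of the conjugates between
  S and v.\<close>

lemma p_Op:
  assumes S: "ne S" and j: "j < k" and v: "v \<in> carrier L"
  shows "p j (Op S v) = finsum L (\<lambda>i. Op (dbl j i S) (p i v)) {..<k}"
proof -
  have e: "(\<lambda>i. Op (Hs ! i) v) \<in> {..<k} \<rightarrow> carrier L" using v Op_closed[OF ne_Hs] by auto
  have jS: "ne ((H #> gs j) <#> S)" by (rule ne_mult[OF ne_H_gs[OF j] S])
  have "p j (Op S v) = Op ((H #> gs j) <#> S) v" by (rule Op_mult[OF ne_H_gs[OF j] S v])
  also have "\<dots> = Op ((H #> gs j) <#> S) (finsum L (\<lambda>i. Op (Hs ! i) v) {..<k})"
    by (simp only: sum_Hs[OF v])
  also have "\<dots> = finsum L (\<lambda>i. Op ((H #> gs j) <#> S) (Op (Hs ! i) v)) {..<k}"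
    by (rule Op_finsum[OF jS e])
  also have "\<dots> = finsum L (\<lambda>i. Op (dbl j i S) (p i v)) {..<k}"
  proof (rule L.finsum_cong'[OF refl])
    show "(\<lambda>i. Op (dbl j i S) (p i v)) \<in> {..<k} \<rightarrow> carrier L"
      using v dbl_props(1)[OF S _ j] ne_H_gs by (auto intro!: Op_closed)
    fix i assume "i \<in> {..<k}"
    then have i: "i < k" by simp
    have G: "{gs j} \<subseteq> carrier G" "S \<subseteq> carrier G" "{inv (gs i)} \<subseteq> carrier G" "{gs i} \<subseteq> carrier G"
      using S gs_closed i j by auto
    \<comment> \<open>In H g_j S g_i^-1 H g_i the middle \<open>H\<close> is written as HH: one copy
      closes the matrix entry, the other opens the coordinate H g_i.\<close>
    have "(H #> gs j) <#> S <#> Hs ! i = dbl j i S <#> (H #> gs i)"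
    proof -
      have H_absorb: "H <#> (H <#> A) = H <#> A" if "A \<subseteq> carrier G" for A
        using that by (simp only: set_mult_assoc[OF H.subset H.subset, symmetric] H_mult_H)
      show ?thesis
        unfolding dbl_def Hs_conj[OF i] conj_H_set_mult H_r_coset
        using G H.subset by (simp only: set_mult_assoc set_mult_closed H_absorb)
    qed
    then show "Op ((H #> gs j) <#> S) (Op (Hs ! i) v) = Op (dbl j i S) (p i v)"
      by (simp only: Op_mult[OF jS ne_Hs[OF i] v] Op_mult[OF dbl_props(1)[OF S i j] ne_H_gs[OF i] v])
  qed
  finally show ?thesis .
qed

abbreviation "form \<equiv> L_form G M \<phi> H U \<rho> Hs gs b"

lemma L_form_eq:
  assumes "v \<in> carrier L" "w \<in> carrier L"
  shows "form v w = (\<Sum>i<k. \<beta> (p i v) (p i w))"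
proof -
  have "form v w = (\<Sum>i<k. \<Sum>j<k. if i = j then \<beta> (p i v) (p j w) else 0)"
    unfolding L_form_def Let_def components_L[OF assms(1)] components_L[OF assms(2)]
      component_form_def
    using assms by (intro sum.cong[OF refl]) (simp add: p_eq)
  also have "\<dots> = (\<Sum>i<k. \<beta> (p i v) (p i w))"
    by (intro sum.cong[OF refl]) simp
  finally show ?thesis .
qed

lemma smult_closed_L: "v \<in> carrier L \<Longrightarrow> c \<odot>\<^bsub>L\<^esub> v \<in> carrier L"
  unfolding L_module_def
  by (auto simp: tp.T_eq tp.carrier_quotient tp.cls_smult formal_span_smult)

lemma hermitian_form: "hermitian_scalar_product L form"
  unfolding hermitian_scalar_product_def
proof (intro conjI ballI allI impI)
  fix u v w assume uvw: "u \<in> carrier L" "v \<in> carrier L" "w \<in> carrier L"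
  then show "form (u \<oplus>\<^bsub>L\<^esub> v) w = form u w + form v w"
    by (simp add: L_form_eq sum.distrib[symmetric] Op_add[OF ne_H_gs] form_add p_V1)
next
  fix c v w assume "v \<in> carrier L" "w \<in> carrier L"
  then show "form (c \<odot>\<^bsub>L\<^esub> v) w = c * form v w"
    by (simp add: L_form_eq sum_distrib_left Op_smult[OF ne_H_gs] form_smult p_V1 smult_closed_L)
next
  fix v w assume vw: "v \<in> carrier L" "w \<in> carrier L"
  then show "form w v = cnj (form v w)"
    unfolding L_form_eq[OF vw] L_form_eq[OF vw(2,1)] cnj_sum
    by (intro sum.cong[OF refl] form_sym p_V1) auto
next
  fix v assume v: "v \<in> carrier L" "v \<noteq> \<zero>\<^bsub>L\<^esub>"
  \<comment> \<open>If all coordinates vanished, so would all components of \<open>v\<close>, and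
    \<open>v\<close> is their sum.\<close>
  have "\<exists>i<k. p i v \<noteq> \<zero>\<^bsub>L\<^esub>"
  proof (rule ccontr)
    assume zero: "\<not> (\<exists>i<k. p i v \<noteq> \<zero>\<^bsub>L\<^esub>)"
    have "Op (Hs ! i) v = \<zero>\<^bsub>L\<^esub>" if "i < k" for i
      using zero that gs_closed[OF that] Op_Hs_from_p[OF that v(1)] Op_zero[of "{inv (gs i)}"] by simp
    then have "finsum L (\<lambda>i. Op (Hs ! i) v) {..<k} = finsum L (\<lambda>i. \<zero>\<^bsub>L\<^esub>) {..<k}"
      by (intro L.finsum_cong') auto
    then show False using sum_Hs[OF v(1)] v(2) by simp
  qed
  then obtain i where i: "i < k" "p i v \<noteq> \<zero>\<^bsub>L\<^esub>" by blast
  have "0 < (\<Sum>i<k. Re (\<beta> (p i v) (p i v)))"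
    using i v by (intro sum_pos2[of _ i]) (auto simp: form_pos form_nonneg p_V1)
  then show "0 < Re (form v v)" by (simp add: L_form_eq v)
qed

lemma Op_dbl_V1:
  "ne S \<Longrightarrow> i < k \<Longrightarrow> j < k \<Longrightarrow> v \<in> carrier L \<Longrightarrow> Op (dbl j i S) (p i v) \<in> V1"
  by (rule Op_V1[OF dbl_props(1,2) Op_closed[OF ne_H_gs]])

lemma form_Op:
  assumes S: "ne S" and v: "v \<in> carrier L" and w: "w \<in> carrier L"
  shows "form (Op S v) w = form v (Op (set_inv S) w)"
proof -
  have S': "ne (set_inv S)" by (rule ne_inv[OF S])
  have "form (Op S v) w = (\<Sum>j<k. \<Sum>i<k. \<beta> (Op (dbl j i S) (p i v)) (p j w))"
    unfolding L_form_eq[OF Op_closed[OF S v] w]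
  proof (rule sum.cong[OF refl])
    fix j assume "j \<in> {..<k}"
    then have j: "j < k" by simp
    have "(\<lambda>i. Op (dbl j i S) (p i v)) \<in> {..<k} \<rightarrow> V1"
      using Op_dbl_V1[OF S _ j v] by simp
    then show "\<beta> (p j (Op S v)) (p j w) = (\<Sum>i<k. \<beta> (Op (dbl j i S) (p i v)) (p j w))"
      unfolding p_Op[OF S j v] by (intro form_sum_left p_V1 j w) auto
  qed
  \<comment> \<open>Entrywise adjunction; inverting an entry swaps its indices, so after exchanging
    the sums the matrix of \<open>set_inv S\<close> acts on the coordinates of
    \<open>w\<close>.\<close>
  also have "\<dots> = (\<Sum>j<k. \<Sum>i<k. \<beta> (p i v) (Op (dbl i j (set_inv S)) (p j w)))"
    using dbl_props[OF S] form_adjoint p_V1 v w by (intro sum.cong[OF refl]) simp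
  also have "\<dots> = (\<Sum>i<k. \<Sum>j<k. \<beta> (p i v) (Op (dbl i j (set_inv S)) (p j w)))"
    by (rule sum.swap)
  also have "\<dots> = form v (Op (set_inv S) w)"
    unfolding L_form_eq[OF v Op_closed[OF S' w]]
  proof (rule sum.cong[OF refl])
    fix i assume "i \<in> {..<k}"
    then have i: "i < k" by simp
    have "(\<lambda>j. Op (dbl i j (set_inv S)) (p j w)) \<in> {..<k} \<rightarrow> V1"
      using Op_dbl_V1[OF S' _ i w] by simp
    then show "(\<Sum>j<k. \<beta> (p i v) (Op (dbl i j (set_inv S)) (p j w))) = \<beta> (p i v) (p i (Op (set_inv S) w))"
      unfolding p_Op[OF S' i w] by (intro form_sum_right[symmetric] p_V1 i v) auto
  qed
  finally show ?thesis .
qed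

end

theorem proposition25:
  fixes G :: "('g, 'z) monoid_scheme" (structure)
    and M :: "'m set"
    and \<phi> :: "'g \<Rightarrow> 'm \<Rightarrow> 'm"
    and H :: "'g set"
    and U :: "(complex, 'x) module"
    and \<rho> :: "'g set \<Rightarrow> 'x \<Rightarrow> 'x"
    and Hs :: "'g set list"
    and gs :: "nat \<Rightarrow> 'g"
    and b :: "('g, 'x) L_elem \<Rightarrow> ('g, 'x) L_elem \<Rightarrow> complex"
  assumes "group G" and "finite (carrier G)" and "finite M"
    and "faithful_action G M \<phi>"
    and "orbit_maximal G M \<phi> H"
    and "simple_representation (normalizer_quotient G H) U \<rho>"
    and "distinct Hs"
    and "set Hs = {inv g <# H #> g | g. g \<in> carrier G}"
    and "Hs ! 0 = H"
    and "gs 0 = \<one>"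
    and "\<forall>i<length Hs. gs i \<in> carrier G \<and> Hs ! i = inv (gs i) <# H #> gs i"
    and "hermitian_scalar_product
           ((L_module G M \<phi> H U \<rho>)\<lparr>carrier := idem_image G M \<phi> H U \<rho> H\<rparr>) b"
  shows "hermitian_scalar_product (L_module G M \<phi> H U \<rho>) (L_form G M \<phi> H U \<rho> Hs gs b) \<and>
    (\<forall>\<sigma>\<in>carrier (factorpower G M \<phi>).
       \<forall>v\<in>carrier (L_module G M \<phi> H U \<rho>). \<forall>w\<in>carrier (L_module G M \<phi> H U \<rho>).
         L_form G M \<phi> H U \<rho> Hs gs b (L_action G M \<phi> H U \<rho> \<sigma> v) w =
         L_form G M \<phi> H U \<rho> Hs gs b v (L_action G M \<phi> H U \<rho> (fp_star G M \<phi> \<sigma>) w))"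
proof -
  interpret factorpower_form G M \<phi> H U \<rho> Hs gs b
  proof (intro factorpower_form.intro factorpower_module.intro maximal_orbit_action.intro
      maximal_orbit_action_axioms.intro factorpower_module_axioms.intro factorpower_form_axioms.intro)
    show "group_action G M \<phi>" using assms(4) by (rule faithful_action.axioms)
    show "linear_representation (normalizer_quotient G H) U \<rho>"
      using assms(6) by (simp add: simple_representation_def)
  qed (use assms in auto)
  show ?thesis
  proof (intro conjI ballI hermitian_form)
    fix \<sigma> v w
    assume "\<sigma> \<in> carrier (factorpower G M \<phi>)"
      and vw: "v \<in> carrier (L_module G M \<phi> H U \<rho>)" "w \<in> carrier (L_module G M \<phi> H U \<rho>)"
    then obtain S where S: "ne S" "\<sigma> = fp_class G M \<phi> S" by (auto simp: carrier_FP)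
    show "L_form G M \<phi> H U \<rho> Hs gs b (L_action G M \<phi> H U \<rho> \<sigma> v) w =
        L_form G M \<phi> H U \<rho> Hs gs b v (L_action G M \<phi> H U \<rho> (fp_star G M \<phi> \<sigma>) w)"
      unfolding S(2) star_cl[OF S(1)] by (rule form_Op[OF S(1) vw])
  qed
qed

end
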